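(* Let $k\ge1$ and let $\phi=(\phi_1,\dots,\phi_k):\mathbb{D}^k\to\overline{\mathbb{D}}^k$ be an analytic map such that $C_\phi f=f\circ\phi$ defines a bounded operator $C_\phi:A^+(\mathbb{T}^k)\to A^+(\mathbb{T}^k)$. Then $C_\phi$ is an automorphism of $A^+(\mathbb{T}^k)$ (a bijective algebra homomorphism onto $A^+(\mathbb{T}^k)$) if and only if $\phi(z)=(\epsilon_1z_{\sigma(1)},\dots,\epsilon_kz_{\sigma(k)})$ for some permutation $\sigma$ of $\{1,\dots,k\}$ and some complex numbers $\epsilon_1,\dots,\epsilon_k$ of modulus $1$.
   Context: $A^+(\mathbb{T}^k)$ is the algebra of functions $f:\overline{\mathbb{D}}^k\to\mathbb{C}$ of the form $f(z)=\sum_{n_1,\dots,n_k\ge0}a(n_1,\dots,n_k)z_1^{n_1}\cdots z_k^{n_k}$ with $\|f\|_{A^+(\mathbb{T}^k)}=\sum|a(n_1,\dots,n_k)|<\infty$, a commutative unital Banach algebra under pointwise multiplication. *)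

theory Defs
  imports "HOL-Complex_Analysis.Complex_Analysis"
begin

text \<open>The dimension k is CARD('n) for a finite index type 'n (so k \<ge> 1 automatically).
  Points of the polydisc are vectors z :: complex ^ 'n; multi-indices are functions 'n \<Rightarrow> nat.\<close>

definition polydisc :: "(complex ^ 'n::finite) set" where
  "polydisc = {z. \<forall>i. norm (z $ i) < 1}"

definition cpolydisc :: "(complex ^ 'n::finite) set" where
  "cpolydisc = {z. \<forall>i. norm (z $ i) \<le> 1}"

definition monomial_pow :: "('n::finite \<Rightarrow> nat) \<Rightarrow> complex ^ 'n \<Rightarrow> complex" where
  "monomial_pow m z = (\<Prod>i\<in>UNIV. (z $ i) ^ m i)"

definition represents :: "(('n::finite \<Rightarrow> nat) \<Rightarrow> complex) \<Rightarrow> (complex ^ 'n \<Rightarrow> complex) \<Rightarrow> bool" where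
  "represents a f \<longleftrightarrow> (\<lambda>m. norm (a m)) summable_on UNIV \<and>
     (\<forall>z\<in>cpolydisc. f z = (\<Sum>\<^sub>\<infinity>m. a m * monomial_pow m z))"

text \<open>A^+(T^k): functions on the closed polydisc (normalised to be 0 outside it, so that
  each element is a unique HOL function) with absolutely summable Taylor coefficients.\<close>
definition Aplus :: "(complex ^ 'n::finite \<Rightarrow> complex) set" where
  "Aplus = {f. (\<exists>a. represents a f) \<and> (\<forall>z. z \<notin> cpolydisc \<longrightarrow> f z = 0)}"

definition Aplus_norm :: "(complex ^ 'n::finite \<Rightarrow> complex) \<Rightarrow> real" where
  "Aplus_norm f = Inf {(\<Sum>\<^sub>\<infinity>m. norm (a m)) | a. represents a f}"

definition Aplus_one :: "complex ^ 'n::finite \<Rightarrow> complex" where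
  "Aplus_one z = (if z \<in> cpolydisc then 1 else 0)"

text \<open>The composition operator C_phi f = f \<circ> phi, viewed as the (unique) element of A^+
  agreeing with f \<circ> phi on the open polydisc.\<close>
definition comp_op :: "(complex ^ 'n::finite \<Rightarrow> complex ^ 'n) \<Rightarrow>
    (complex ^ 'n \<Rightarrow> complex) \<Rightarrow> (complex ^ 'n \<Rightarrow> complex)" where
  "comp_op \<phi> f = (THE g. g \<in> Aplus \<and> (\<forall>z\<in>polydisc. g z = f (\<phi> z)))"

text \<open>Holomorphy of a map of several complex variables on an open set (Osgood's definition:
  continuous and holomorphic in each variable separately).\<close>
definition holomorphic_several :: "(complex ^ 'n::finite \<Rightarrow> complex ^ 'm::finite) \<Rightarrow>
    (complex ^ 'n) set \<Rightarrow> bool" where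
  "holomorphic_several \<phi> S \<longleftrightarrow> continuous_on S \<phi> \<and>
     (\<forall>z\<in>S. \<forall>i j. (\<lambda>w. \<phi> (\<chi> l. if l = i then w else z $ l) $ j) field_differentiable (at (z $ i)))"

definition comp_op_bounded :: "(complex ^ 'n::finite \<Rightarrow> complex ^ 'n) \<Rightarrow> bool" where
  "comp_op_bounded \<phi> \<longleftrightarrow>
     (\<forall>f\<in>Aplus. \<exists>g\<in>Aplus. \<forall>z\<in>polydisc. g z = f (\<phi> z)) \<and>
     (\<exists>C. \<forall>f\<in>Aplus. Aplus_norm (comp_op \<phi> f) \<le> C * Aplus_norm f)"

definition Aplus_automorphism :: "((complex ^ 'n::finite \<Rightarrow> complex) \<Rightarrow> (complex ^ 'n \<Rightarrow> complex)) \<Rightarrow> bool" where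
  "Aplus_automorphism T \<longleftrightarrow> bij_betw T Aplus Aplus \<and>
     (\<forall>f\<in>Aplus. \<forall>g\<in>Aplus. T (\<lambda>z. f z + g z) = (\<lambda>z. T f z + T g z)) \<and>
     (\<forall>c. \<forall>f\<in>Aplus. T (\<lambda>z. c * f z) = (\<lambda>z. c * T f z)) \<and>
     (\<forall>f\<in>Aplus. \<forall>g\<in>Aplus. T (\<lambda>z. f z * g z) = (\<lambda>z. T f z * T g z)) \<and>
     T Aplus_one = Aplus_one"

end

theory Submission
  imports Defs
begin

text \<open>
  Let \<open>T = C\<^sub>\<phi>\<close> be an automorphism and \<open>g\<^sub>i = T\<^sup>-\<^sup>1 z\<^sub>i\<close>. For \<open>|\<lambda>| > 1\<close> the function
  \<open>\<lambda> - g\<^sub>i\<close> is invertible because \<open>\<lambda> - z\<^sub>i\<close> is, so \<open>|g\<^sub>i| \<le> 1\<close> and \<open>g\<close> is a left inverse of \<open>\<phi>\<close> between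
  polydiscs. After moving \<open>\<phi> 0\<close> to 0 by disc automorphisms, the Schwarz lemma for \<open>\<phi>\<close> and \<open>g\<close> shows
  that for every \<open>i\<close> some component \<open>\<phi>\<^sub>j\<close> restricts to a Moebius map on the \<open>i\<close>-th coordinate axis.

  The powers of \<open>\<phi>\<^sub>j\<close> have bounded norm, which forces this Moebius map to be a rotation: on the
  \<open>Q\<close>-th roots of unity an \<open>\<ell>\<^sup>1\<close> bound on coefficients bounds the fourth moment of the discrete
  Fourier transform from below, while its average over all powers counts the solutions of a
  quadratic equation and is \<open>O(1/Q)\<close>.

  Finally \<open>\<phi>\<^sub>j\<close> is unimodular at the boundary points of the \<open>i\<close>-th axis, so by the maximum principle
  it does not depend on the remaining variables.
\<close>

no_notation fps_nth (infixl \<open>$\<close> 75)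
no_notation Infinite_Set_Sum.abs_summable_on (infix \<open>abs'_summable'_on\<close> 50)

section \<open>Polydiscs and monomials\<close>

lemma polydisc_subset_cpolydisc: "polydisc \<subseteq> cpolydisc"
  by (auto simp: polydisc_def cpolydisc_def less_imp_le)

lemma polydisc_imp_cpolydisc: "z \<in> polydisc \<Longrightarrow> z \<in> cpolydisc"
  using polydisc_subset_cpolydisc by blast

lemma norm_nth_le_1: "z \<in> cpolydisc \<Longrightarrow> norm (z $ i) \<le> 1"
  by (simp add: cpolydisc_def)

lemma zero_in_polydisc [simp]: "0 \<in> polydisc"
  by (simp add: polydisc_def)

lemma axis_zero_complex [simp]: "axis i (0::complex) = 0"
  by (simp add: axis_def vec_eq_iff)

lemma axis_in_polydisc_iff [simp]: "axis i x \<in> polydisc \<longleftrightarrow> norm x < 1"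
  by (auto simp: polydisc_def axis_def split: if_splits)

lemma axis_in_cpolydisc_iff [simp]: "axis i x \<in> cpolydisc \<longleftrightarrow> norm x \<le> 1"
  by (auto simp: cpolydisc_def axis_def split: if_splits)

lemma scale_in_cpolydisc: "norm s \<le> 1 \<Longrightarrow> z \<in> cpolydisc \<Longrightarrow> s *s z \<in> cpolydisc"
  by (auto simp: cpolydisc_def norm_mult intro: mult_le_one)

lemma scale_in_polydisc:
  assumes "norm s < 1" "z \<in> cpolydisc"
  shows "s *s z \<in> polydisc"
  using mult_right_le_one_le[OF norm_ge_zero norm_ge_zero norm_nth_le_1[OF assms(2)], of s] assms(1)
  by (auto simp: polydisc_def norm_mult intro: le_less_trans)

lemma closure_polydisc: "closure polydisc = (cpolydisc :: (complex ^ 'n::finite) set)"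
proof
  have "closed (cpolydisc :: (complex ^ 'n) set)"
    unfolding cpolydisc_def by (intro closed_Collect_all closed_Collect_le continuous_intros)
  then show "closure polydisc \<subseteq> (cpolydisc :: (complex ^ 'n) set)"
    by (rule closure_minimal[OF polydisc_subset_cpolydisc])
  show "cpolydisc \<subseteq> closure (polydisc :: (complex ^ 'n) set)"
  proof
    fix z :: "complex ^ 'n"
    assume z: "z \<in> cpolydisc"
    have "continuous_on (closure (ball 0 1)) (\<lambda>s::complex. s *s z)"
      unfolding vector_scalar_mult_def by (intro continuous_on_vec_lambda continuous_intros)
    moreover have "(\<lambda>s::complex. s *s z) ` ball 0 1 \<subseteq> closure polydisc"
      using z closure_subset by (force intro: scale_in_polydisc)
    ultimately have "(\<lambda>s::complex. s *s z) ` closure (ball 0 1) \<subseteq> closure polydisc"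
      by (intro image_closure_subset) auto
    then have "(1::complex) *s z \<in> closure polydisc"
      by (rule subsetD) (rule imageI, simp)
    then show "z \<in> closure polydisc" by simp
  qed
qed

definition single_index :: "'n \<Rightarrow> nat \<Rightarrow> 'n \<Rightarrow> nat" where
  "single_index i n l = (if l = i then n else 0)"

lemma inj_single_index: "inj (single_index i)"
  by (rule injI) (metis single_index_def)

lemma norm_monomial_pow_le_1: "z \<in> cpolydisc \<Longrightarrow> norm (monomial_pow m z) \<le> 1"
  by (auto simp: monomial_pow_def cpolydisc_def norm_power prod_norm [symmetric]
      intro!: prod_le_1 power_le_one)

lemma monomial_pow_add:
  "monomial_pow (\<lambda>i. p i + q i) z = monomial_pow p z * monomial_pow q z"
  by (simp add: monomial_pow_def power_add prod.distrib)

lemma monomial_pow_single_index: "monomial_pow (single_index i n) z = (z $ i) ^ n"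
proof -
  have "monomial_pow (single_index i n) z = (\<Prod>l\<in>UNIV. if l = i then (z $ i) ^ n else 1)"
    unfolding monomial_pow_def by (intro prod.cong) (auto simp: single_index_def)
  then show ?thesis by simp
qed

lemma monomial_pow_axis_eq_0:
  assumes "m \<notin> range (single_index i)"
  shows "monomial_pow m (axis i x) = 0"
proof -
  have "m \<noteq> single_index i (m i)"
    using assms rangeI[of "single_index i" "m i"] by metis
  then obtain l where "m l \<noteq> single_index i (m i) l"
    unfolding fun_eq_iff by blast
  then have "l \<noteq> i" "m l \<noteq> 0"
    by (auto simp: single_index_def split: if_splits)
  then have "(axis i x $ l) ^ m l = 0"
    by (simp add: axis_def)
  then show ?thesis
    unfolding monomial_pow_def by (intro prod_zero) auto
qed

section \<open>The algebra of absolutely convergent power series\<close>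

lemma abs_summable_mult_monomial_pow:
  assumes "c abs_summable_on A" "z \<in> cpolydisc"
  shows "(\<lambda>k. c k * monomial_pow (d k) z) abs_summable_on A"
  using assms(1)
  by (rule summable_on_comparison_test)
     (auto simp: norm_mult intro: mult_right_le_one_le norm_monomial_pow_le_1[OF assms(2)])

lemma represents_abs_summable: "represents a f \<Longrightarrow> a abs_summable_on UNIV"
  by (simp add: represents_def)

lemma represents_has_sum:
  assumes "represents a f" "z \<in> cpolydisc"
  shows "((\<lambda>m. a m * monomial_pow m z) has_sum f z) UNIV"
proof -
  have "(\<lambda>m. a m * monomial_pow m z) summable_on UNIV"
    by (rule abs_summable_summable[OF abs_summable_mult_monomial_pow[OF
            represents_abs_summable[OF assms(1)] assms(2)]])
  then show ?thesis
    using assms by (auto simp: represents_def)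
qed

lemma AplusE:
  assumes "f \<in> Aplus"
  obtains a where "represents a f"
  using assms by (auto simp: Aplus_def)

lemma Aplus_outside: "f \<in> Aplus \<Longrightarrow> z \<notin> cpolydisc \<Longrightarrow> f z = 0"
  by (simp add: Aplus_def)

lemma has_sum_fibres:
  fixes c :: "'b \<Rightarrow> 'a::banach"
  assumes "(c has_sum s) UNIV"
  shows "((\<lambda>p. \<Sum>\<^sub>\<infinity>k\<in>d -` {p}. c k) has_sum s) UNIV"
proof (rule has_sum_SigmaD)
  have "bij_betw snd (Sigma UNIV (\<lambda>p. d -` {p})) UNIV"
    by (rule bij_betwI[where g = "\<lambda>k. (d k, k)"]) auto
  then show "((\<lambda>x. c (snd x)) has_sum s) (Sigma UNIV (\<lambda>p. d -` {p}))"
    using assms by (simp add: has_sum_reindex_bij_betw)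
  have "c summable_on d -` {p}" for p
    using has_sum_imp_summable[OF assms] by (rule summable_on_subset_banach) simp
  then show "((\<lambda>k. c (snd (p, k))) has_sum (\<Sum>\<^sub>\<infinity>k\<in>d -` {p}. c k)) (d -` {p})" for p
    by simp
qed

text \<open>Repeated exponents are allowed here; the coefficient of a multi-index is the sum of the
  weights over the corresponding fibre.\<close>
lemma Aplus_familyI:
  fixes c :: "'b \<Rightarrow> complex" and d :: "'b \<Rightarrow> 'n::finite \<Rightarrow> nat"
  assumes summable: "c abs_summable_on UNIV"
    and expansion: "\<And>z. z \<in> cpolydisc \<Longrightarrow> ((\<lambda>k. c k * monomial_pow (d k) z) has_sum f z) UNIV"
    and outside: "\<And>z. z \<notin> cpolydisc \<Longrightarrow> f z = 0"
  shows "f \<in> Aplus"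
proof -
  define a where "a p = (\<Sum>\<^sub>\<infinity>k\<in>d -` {p}. c k)" for p
  have fibre: "c abs_summable_on d -` {p}" for p
    using summable by (rule summable_on_subset_banach) simp
  have "(\<lambda>p. \<Sum>\<^sub>\<infinity>k\<in>d -` {p}. norm (c k)) summable_on UNIV"
    using has_sum_fibres[OF has_sum_infsum[OF summable]] by (rule has_sum_imp_summable)
  then have "a abs_summable_on UNIV"
    by (rule summable_on_comparison_test) (auto simp: a_def fibre intro: norm_infsum_bound)
  moreover have "f z = (\<Sum>\<^sub>\<infinity>p. a p * monomial_pow p z)" if z: "z \<in> cpolydisc" for z
  proof -
    have "(\<Sum>\<^sub>\<infinity>k\<in>d -` {p}. c k * monomial_pow (d k) z) = a p * monomial_pow p z" for p
    proof -
      have "(\<Sum>\<^sub>\<infinity>k\<in>d -` {p}. c k * monomial_pow (d k) z) =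
          (\<Sum>\<^sub>\<infinity>k\<in>d -` {p}. c k * monomial_pow p z)"
        by (rule infsum_cong) auto
      then show ?thesis
        by (simp add: a_def infsum_cmult_left')
    qed
    then show ?thesis
      using has_sum_fibres[OF expansion[OF z], of d] by (simp add: infsumI)
  qed
  ultimately show ?thesis
    using outside by (auto simp: Aplus_def represents_def)
qed

lemma Aplus_add:
  assumes "f \<in> Aplus" "g \<in> Aplus"
  shows "(\<lambda>z. f z + g z) \<in> Aplus"
proof -
  obtain a b where a: "represents a f" and b: "represents b g"
    using assms by (meson AplusE)
  show ?thesis
  proof (rule Aplus_familyI[where c = "\<lambda>m. a m + b m" and d = "\<lambda>m. m"])
    show "(\<lambda>m. a m + b m) abs_summable_on UNIV"
      by (rule summable_on_comparison_test[OF
            summable_on_add[OF represents_abs_summable[OF a] represents_abs_summable[OF b]]])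
         (auto intro: norm_triangle_ineq)
    show "((\<lambda>m. (a m + b m) * monomial_pow m z) has_sum (f z + g z)) UNIV"
      if "z \<in> cpolydisc" for z
      using has_sum_add[OF represents_has_sum[OF a that] represents_has_sum[OF b that]]
      by (simp add: distrib_right)
  qed (simp add: Aplus_outside assms)
qed

lemma Aplus_cmult:
  assumes "f \<in> Aplus"
  shows "(\<lambda>z. c * f z) \<in> Aplus"
proof -
  obtain a where a: "represents a f"
    using assms by (rule AplusE)
  show ?thesis
  proof (rule Aplus_familyI[where c = "\<lambda>m. c * a m" and d = "\<lambda>m. m"])
    show "(\<lambda>m. c * a m) abs_summable_on UNIV"
      by (simp add: norm_mult summable_on_cmult_right represents_abs_summable[OF a])
    show "((\<lambda>m. c * a m * monomial_pow m z) has_sum (c * f z)) UNIV"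
      if "z \<in> cpolydisc" for z
      using has_sum_cmult_right[OF represents_has_sum[OF a that], of c] by (simp add: mult.assoc)
  qed (simp add: Aplus_outside assms)
qed

lemma abs_summable_on_mult:
  fixes a :: "'b \<Rightarrow> 'a::{real_normed_field, banach}"
  assumes "a abs_summable_on A" "b abs_summable_on B"
  shows "(\<lambda>k. a (fst k) * b (snd k)) abs_summable_on A \<times> B"
proof (rule summable_on_SigmaI)
  show "((\<lambda>y. norm (a (fst (x, y)) * b (snd (x, y)))) has_sum
      (norm (a x) * (\<Sum>\<^sub>\<infinity>l\<in>B. norm (b l)))) B" for x
    using has_sum_cmult_right[OF has_sum_infsum[OF assms(2)]] by (simp add: norm_mult)
qed (auto intro: summable_on_cmult_left assms(1))

lemma has_sum_mult:
  fixes a :: "'b \<Rightarrow> 'a::{real_normed_field, banach}"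
  assumes "a abs_summable_on A" "(a has_sum s) A" "b abs_summable_on B" "(b has_sum t) B"
  shows "((\<lambda>k. a (fst k) * b (snd k)) has_sum (s * t)) (A \<times> B)"
proof (rule has_sum_SigmaI)
  show "((\<lambda>y. a (fst (x, y)) * b (snd (x, y))) has_sum (a x * t)) B" for x
    using has_sum_cmult_right[OF assms(4)] by simp
  show "((\<lambda>x. a x * t) has_sum (s * t)) A"
    by (rule has_sum_cmult_left[OF assms(2)])
  show "(\<lambda>k. a (fst k) * b (snd k)) summable_on A \<times> B"
    by (rule abs_summable_summable[OF abs_summable_on_mult[OF assms(1,3)]])
qed

lemma Aplus_mult:
  assumes "f \<in> Aplus" "g \<in> Aplus"
  shows "(\<lambda>z. f z * g z) \<in> Aplus"
proof -
  obtain a b where a: "represents a f" and b: "represents b g"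
    using assms by (meson AplusE)
  show ?thesis
  proof (rule Aplus_familyI[where c = "\<lambda>k. a (fst k) * b (snd k)"
        and d = "\<lambda>k i. fst k i + snd k i"])
    show "(\<lambda>k. a (fst k) * b (snd k)) abs_summable_on UNIV"
      using abs_summable_on_mult[OF represents_abs_summable[OF a] represents_abs_summable[OF b]]
      by simp
    show "((\<lambda>k. a (fst k) * b (snd k) * monomial_pow (\<lambda>i. fst k i + snd k i) z) has_sum
        (f z * g z)) UNIV" if z: "z \<in> cpolydisc" for z
    proof -
      have "((\<lambda>k. (a (fst k) * monomial_pow (fst k) z) * (b (snd k) * monomial_pow (snd k) z))
          has_sum (f z * g z)) (UNIV \<times> UNIV)"
        by (rule has_sum_mult[OF
              abs_summable_mult_monomial_pow[OF represents_abs_summable[OF a] z]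
              represents_has_sum[OF a z]
              abs_summable_mult_monomial_pow[OF represents_abs_summable[OF b] z]
              represents_has_sum[OF b z]])
      then show ?thesis
        by (simp add: monomial_pow_add mult_ac)
    qed
  qed (simp add: Aplus_outside assms)
qed

definition coord_pow :: "'n::finite \<Rightarrow> nat \<Rightarrow> complex ^ 'n \<Rightarrow> complex" where
  "coord_pow i n z = (if z \<in> cpolydisc then (z $ i) ^ n else 0)"

lemma represents_coord_pow:
  "represents (\<lambda>m. if m = single_index i n then 1 else 0) (coord_pow i n)"
proof -
  have "((\<lambda>m. (if m = single_index i n then 1 else 0) * monomial_pow m z) has_sum (z $ i) ^ n) UNIV"
    for z
    by (rule has_sum_finite_neutralI[where B = "{single_index i n}"])
       (auto simp: monomial_pow_single_index)
  moreover have "(\<lambda>m. if m = single_index i n then 1 else 0 :: complex) abs_summable_on UNIV"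
    by (rule finite_nonzero_values_imp_summable_on) auto
  ultimately show ?thesis
    by (auto simp: represents_def coord_pow_def intro!: infsumI[symmetric])
qed

lemma coord_pow_in_Aplus [simp]: "coord_pow i n \<in> Aplus"
  using represents_coord_pow[of i n] by (auto simp: Aplus_def coord_pow_def)

lemma coord_pow_0: "coord_pow i 0 = Aplus_one"
  by (auto simp: Aplus_one_def coord_pow_def)

lemma coord_pow_Suc: "coord_pow i (Suc n) = (\<lambda>z. coord_pow i 1 z * coord_pow i n z)"
  by (auto simp: coord_pow_def)

lemma Aplus_one_in_Aplus [simp]: "Aplus_one \<in> Aplus"
  by (simp flip: coord_pow_0[of undefined])

lemma Aplus_resolvent:
  fixes i :: "'n::finite"
  assumes "norm \<mu> > 1"
  obtains h where "h \<in> Aplus" "(\<lambda>z. (\<mu> * Aplus_one z - coord_pow i 1 z) * h z) = Aplus_one"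
proof
  let ?h = "\<lambda>z::complex ^ 'n. if z \<in> cpolydisc then inverse (\<mu> - z $ i) else 0"
  have \<mu>: "norm (inverse \<mu>) < 1" "\<mu> \<noteq> 0"
    using assms by (auto simp: norm_inverse inverse_less_1_iff)
  have nonzero: "\<mu> - z $ i \<noteq> 0" if "z \<in> cpolydisc" for z
    using norm_nth_le_1[OF that, of i] assms by auto
  then show "(\<lambda>z. (\<mu> * Aplus_one z - coord_pow i 1 z) * ?h z) = Aplus_one"
    by (auto simp: coord_pow_def Aplus_one_def)
  show "?h \<in> Aplus"
  proof (rule Aplus_familyI[where c = "\<lambda>n. inverse \<mu> ^ Suc n" and d = "single_index i"])
    show "(\<lambda>n. inverse \<mu> ^ Suc n) abs_summable_on UNIV"
      using \<mu>(1) by (simp add: norm_power norm_mult summable_on_UNIV_nonneg_real_iff summable_mult)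
    fix z :: "complex ^ 'n" assume z: "z \<in> cpolydisc"
    define q where "q = inverse \<mu> * z $ i"
    have "norm q < 1"
      using \<mu>(1) norm_nth_le_1[OF z, of i]
        mult_right_le_one_le[of "norm (inverse \<mu>)" "norm (z $ i)"]
      by (simp add: q_def norm_mult)
    then have "((\<lambda>n. q ^ n) has_sum (1 / (1 - q))) UNIV"
      by (intro norm_summable_imp_has_sum geometric_sums) (auto simp: norm_power)
    then have "((\<lambda>n. inverse \<mu> * q ^ n) has_sum (inverse \<mu> * (1 / (1 - q)))) UNIV"
      by (rule has_sum_cmult_right)
    moreover have "inverse \<mu> * (1 / (1 - q)) = inverse (\<mu> - z $ i)"
      using \<mu> nonzero[OF z] by (simp add: q_def field_simps)
    ultimately show "((\<lambda>n. inverse \<mu> ^ Suc n * monomial_pow (single_index i n) z) has_sum ?h z) UNIV"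
      using z by (simp add: monomial_pow_single_index q_def power_mult_distrib mult_ac)
  qed simp
qed

lemma Aplus_norm_le:
  assumes "represents a f"
  shows "Aplus_norm f \<le> (\<Sum>\<^sub>\<infinity>m. norm (a m))"
  unfolding Aplus_norm_def
  by (rule cInf_lower) (use assms in \<open>auto intro!: bdd_belowI[of _ 0] infsum_nonneg\<close>)

lemma Aplus_norm_nonneg: "f \<in> Aplus \<Longrightarrow> Aplus_norm f \<ge> 0"
  unfolding Aplus_norm_def
  by (rule cInf_greatest) (auto simp: Aplus_def intro!: infsum_nonneg)

lemma Aplus_norm_coord_pow_le_1: "Aplus_norm (coord_pow i n) \<le> 1"
proof -
  have "((\<lambda>m. norm (if m = single_index i n then 1 else 0 :: complex)) has_sum 1) UNIV"
    by (rule has_sum_finite_neutralI[where B = "{single_index i n}"]) auto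
  then show ?thesis
    using Aplus_norm_le[OF represents_coord_pow[of i n]] by (simp add: infsumI)
qed

lemma Aplus_norm_lessE:
  assumes "f \<in> Aplus" "Aplus_norm f < K"
  obtains a where "represents a f" "(\<Sum>\<^sub>\<infinity>m. norm (a m)) < K"
proof -
  have "{(\<Sum>\<^sub>\<infinity>m. norm (a m)) | a. represents a f} \<noteq> {}"
    using assms(1) by (auto simp: Aplus_def)
  from cInf_lessD[OF this] assms(2) that show ?thesis
    unfolding Aplus_norm_def by blast
qed

definition abs_power_series_on :: "complex set \<Rightarrow> (complex \<Rightarrow> complex) \<Rightarrow> real \<Rightarrow> bool" where
  "abs_power_series_on S f K \<longleftrightarrow>
     (\<exists>c::nat \<Rightarrow> complex. c abs_summable_on UNIV \<and> (\<Sum>\<^sub>\<infinity>n. norm (c n)) \<le> K \<and>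
        (\<forall>x\<in>S. ((\<lambda>n. c n * x ^ n) has_sum f x) UNIV))"

lemma abs_power_series_on_cong:
  "(\<And>x. x \<in> S \<Longrightarrow> f x = g x) \<Longrightarrow> abs_power_series_on S f K \<longleftrightarrow> abs_power_series_on S g K"
  by (simp add: abs_power_series_on_def)

lemma abs_power_series_on_subset:
  "abs_power_series_on S f K \<Longrightarrow> T \<subseteq> S \<Longrightarrow> abs_power_series_on T f K"
  unfolding abs_power_series_on_def by blast

lemma abs_power_series_on_axis:
  assumes "f \<in> Aplus" "Aplus_norm f < K"
  shows "abs_power_series_on (cball 0 1) (\<lambda>x. f (axis i x)) K"
proof -
  obtain a where a: "represents a f" and a_less: "(\<Sum>\<^sub>\<infinity>m. norm (a m)) < K"
    using Aplus_norm_lessE[OF assms] .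
  define c where "c n = a (single_index i n)" for n
  have norm_c: "(\<lambda>n. norm (c n)) = (\<lambda>m. norm (a m)) \<circ> single_index i"
    by (simp add: c_def o_def)
  have restrict: "a abs_summable_on range (single_index i)"
    using represents_abs_summable[OF a] by (rule summable_on_subset_banach) simp
  then have "c abs_summable_on UNIV"
    unfolding norm_c by (rule summable_on_reindex[OF inj_single_index, THEN iffD1])
  moreover have "(\<Sum>\<^sub>\<infinity>n. norm (c n)) \<le> K"
  proof -
    have "(\<Sum>\<^sub>\<infinity>n. norm (c n)) = (\<Sum>\<^sub>\<infinity>m\<in>range (single_index i). norm (a m))"
      unfolding norm_c by (rule infsum_reindex[OF inj_single_index, symmetric])
    also have "\<dots> \<le> (\<Sum>\<^sub>\<infinity>m. norm (a m))"
      by (intro infsum_mono2 restrict represents_abs_summable[OF a]) auto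
    finally show ?thesis using a_less by simp
  qed
  moreover have "((\<lambda>n. c n * x ^ n) has_sum f (axis i x)) UNIV" if "x \<in> cball 0 1" for x
  proof -
    let ?t = "\<lambda>m. a m * monomial_pow m (axis i x)"
    have "(?t has_sum f (axis i x)) UNIV"
      using that by (intro represents_has_sum[OF a]) simp
    moreover have "(?t has_sum f (axis i x)) (range (single_index i)) \<longleftrightarrow>
        (?t has_sum f (axis i x)) UNIV"
      by (rule has_sum_cong_neutral) (auto simp: monomial_pow_axis_eq_0)
    ultimately show ?thesis
      by (simp add: has_sum_reindex[OF inj_single_index] o_def monomial_pow_single_index c_def)
  qed
  ultimately show ?thesis
    by (auto simp: abs_power_series_on_def)
qed

section \<open>Analyticity of the elements of the algebra\<close>

lemma Aplus_uniform_limit: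
  assumes "represents a f" "\<And>x. x \<in> S \<Longrightarrow> \<gamma> x \<in> cpolydisc"
  shows "uniform_limit S (\<lambda>X x. \<Sum>m\<in>X. a m * monomial_pow m (\<gamma> x)) (\<lambda>x. f (\<gamma> x))
    (finite_subsets_at_top UNIV)"
proof (rule Weierstrass_m_test_general')
  show "norm (a m * monomial_pow m (\<gamma> x)) \<le> norm (a m)" if "x \<in> S" for m x
    by (simp add: norm_mult mult_right_le_one_le norm_monomial_pow_le_1 assms that)
  show "((\<lambda>m. a m * monomial_pow m (\<gamma> x)) has_sum f (\<gamma> x)) UNIV" if "x \<in> S" for x
    by (rule represents_has_sum[OF assms(1) assms(2)[OF that]])
qed (rule represents_abs_summable[OF assms(1)])

lemma continuous_on_Aplus:
  assumes "f \<in> Aplus"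
  shows "continuous_on cpolydisc f"
proof -
  obtain a where a: "represents a f"
    using assms by (rule AplusE)
  show ?thesis
    by (rule uniform_limit_theorem[OF _ Aplus_uniform_limit[OF a]])
       (auto simp: monomial_pow_def intro!: always_eventually continuous_intros)
qed

lemma continuous_on_Aplus_compose:
  assumes "f \<in> Aplus" "continuous_on S \<gamma>" "\<And>x. x \<in> S \<Longrightarrow> \<gamma> x \<in> cpolydisc"
  shows "continuous_on S (\<lambda>x. f (\<gamma> x))"
  using assms by (intro continuous_on_compose2[OF continuous_on_Aplus]) auto

lemma holomorphic_on_Aplus_compose:
  fixes \<gamma> :: "complex \<Rightarrow> complex ^ 'n::finite"
  assumes "f \<in> Aplus" "open S" "\<And>x. x \<in> S \<Longrightarrow> \<gamma> x \<in> cpolydisc"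
    and "\<And>l. (\<lambda>x. \<gamma> x $ l) holomorphic_on S"
  shows "(\<lambda>x. f (\<gamma> x)) holomorphic_on S"
proof -
  obtain a where a: "represents a f"
    using assms(1) by (rule AplusE)
  define partial where "partial X x = (\<Sum>m\<in>X. a m * monomial_pow m (\<gamma> x))" for X x
  have limit: "uniform_limit S partial (\<lambda>x. f (\<gamma> x)) (finite_subsets_at_top UNIV)"
    unfolding partial_def by (rule Aplus_uniform_limit[OF a assms(3)])
  have partial_holomorphic: "partial X holomorphic_on S" for X
    unfolding partial_def monomial_pow_def by (intro holomorphic_intros assms(4))
  have "(\<lambda>x. f (\<gamma> x)) field_differentiable at x" if "x \<in> S" for x
  proof -
    obtain r where r: "r > 0" "cball x r \<subseteq> S"
      using assms(2) \<open>x \<in> S\<close> by (meson open_contains_cball)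
    have "(\<lambda>x. f (\<gamma> x)) holomorphic_on ball x r"
    proof (rule holomorphic_uniform_limit[OF _ uniform_limit_on_subset[OF limit r(2)]])
      show "\<forall>\<^sub>F X in finite_subsets_at_top UNIV.
          continuous_on (cball x r) (partial X) \<and> partial X holomorphic_on ball x r"
        using r(2) ball_subset_cball[of x r]
        by (intro always_eventually allI conjI holomorphic_on_imp_continuous_on
            holomorphic_on_subset[OF partial_holomorphic]) auto
    qed auto
    then show ?thesis
      using r(1) by (auto simp: holomorphic_on_open field_differentiable_def)
  qed
  then show ?thesis
    by (auto simp: holomorphic_on_def intro: field_differentiable_at_within)
qed

lemma continuous_on_axis [continuous_intros]:
  fixes f :: "'a::topological_space \<Rightarrow> complex"
  assumes "continuous_on S f"
  shows "continuous_on S (\<lambda>x. axis i (f x))"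
proof -
  have "continuous_on S (\<lambda>x. if l = i then f x else 0)" for l
    using assms by (cases "l = i") auto
  then show ?thesis
    unfolding axis_def by (rule continuous_on_vec_lambda)
qed

lemma holomorphic_on_axis_nth: "(\<lambda>x. axis i x $ l) holomorphic_on S"
  by (cases "l = i") (auto simp: axis_def)

lemma Aplus_eqI:
  assumes "f \<in> Aplus" "g \<in> Aplus" "\<And>z. z \<in> polydisc \<Longrightarrow> f z = g z"
  shows "f = g"
proof
  fix z
  show "f z = g z"
  proof (cases "z \<in> cpolydisc")
    case True
    have "f z - g z = 0"
      by (rule continuous_constant_on_closure[of polydisc])
         (use assms True in \<open>auto simp: closure_polydisc
             intro!: continuous_on_diff[OF continuous_on_Aplus continuous_on_Aplus]\<close>)
    then show ?thesis by simp
  qed (simp add: Aplus_outside assms)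
qed

lemma Aplus_norm_le_1_on_closure:
  assumes "f \<in> Aplus" "\<And>z. z \<in> polydisc \<Longrightarrow> norm (f z) \<le> 1" "z \<in> cpolydisc"
  shows "norm (f z) \<le> 1"
  by (rule continuous_on_closure_norm_le[of polydisc f])
     (use assms in \<open>auto simp: closure_polydisc intro: continuous_on_Aplus\<close>)

subsection \<open>The maximum principle\<close>

lemma holomorphic_norm_le_1_constant:
  assumes "f holomorphic_on ball 0 1" "\<And>z. norm z < 1 \<Longrightarrow> norm (f z) \<le> 1"
    and "norm \<xi> < 1" "norm (f \<xi>) = 1" "norm z < 1"
  shows "f z = f \<xi>"
proof -
  have "f constant_on ball 0 1"
    by (rule maximum_modulus_principle[where U = "ball 0 1" and \<xi> = \<xi>]) (use assms in auto)
  then show ?thesis using assms by (auto simp: constant_on_def)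
qed

lemma holomorphic_norm_less_1:
  assumes "f holomorphic_on ball 0 1" "\<And>z. norm z < 1 \<Longrightarrow> norm (f z) \<le> 1"
    and "norm (f \<xi>) < 1" "norm \<xi> < 1" "norm z < 1"
  shows "norm (f z) < 1"
  using holomorphic_norm_le_1_constant[OF assms(1,2) \<open>norm z < 1\<close>, of \<xi>]
    assms(2)[OF assms(5)] assms(3,4)
  by (cases "norm (f z) = 1") auto

lemma
  assumes "f \<in> Aplus" "\<And>s. norm s \<le> 1 \<Longrightarrow> w + s *s v \<in> cpolydisc"
  shows continuous_on_Aplus_line: "continuous_on (cball 0 1) (\<lambda>s. f (w + s *s v))"
    and holomorphic_on_Aplus_line: "(\<lambda>s. f (w + s *s v)) holomorphic_on ball 0 1"
proof -
  have "continuous_on (cball 0 1) (\<lambda>s. w + s *s v)"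
    unfolding vector_scalar_mult_def by (intro continuous_on_vec_lambda continuous_intros)
  then show "continuous_on (cball 0 1) (\<lambda>s. f (w + s *s v))"
    by (rule continuous_on_Aplus_compose[OF assms(1)]) (simp add: assms(2))
  show "(\<lambda>s. f (w + s *s v)) holomorphic_on ball 0 1"
    by (rule holomorphic_on_Aplus_compose[OF assms(1)])
       (auto simp: assms(2) intro!: holomorphic_intros)
qed

lemma Aplus_constant_on_complex_line:
  assumes "f \<in> Aplus" "\<And>z. z \<in> cpolydisc \<Longrightarrow> norm (f z) \<le> 1"
    and line: "\<And>s. norm s \<le> 1 \<Longrightarrow> w + s *s v \<in> cpolydisc"
    and "norm (f w) = 1"
  shows "f (w + v) = f w"
proof -
  have interior: "f (w + s *s v) = f w" if "norm s < 1" for s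
    using holomorphic_norm_le_1_constant[OF holomorphic_on_Aplus_line[OF assms(1) line], of 0 s]
      that assms(2,4) line by simp
  have "f (w + 1 *s v) = f w"
    by (rule continuous_constant_on_closure[where S = "ball 0 1" and x = "1::complex"
          and f = "\<lambda>s. f (w + s *s v)"])
       (use continuous_on_Aplus_line[OF assms(1) line] interior in auto)
  then show ?thesis by simp
qed

lemma Aplus_constant_if_unimodular_at_0:
  assumes "f \<in> Aplus" "\<And>z. z \<in> cpolydisc \<Longrightarrow> norm (f z) \<le> 1" "norm (f 0) = 1" "z \<in> cpolydisc"
  shows "f z = f 0"
  using Aplus_constant_on_complex_line[OF assms(1,2), of 0 z] assms(3,4)
  by (simp add: scale_in_cpolydisc)

text \<open>On \<open>{z\<^sub>i = x}\<close> with \<open>|x| = 1\<close> the function is constant, as it is unimodular at the centre of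
  this polydisc; the maximum principle in the variable \<open>z\<^sub>i\<close> then fills the interior.\<close>
lemma Aplus_eq_rotation_on_axis_imp_eq:
  assumes f: "f \<in> Aplus" and f_le: "\<And>z. z \<in> cpolydisc \<Longrightarrow> norm (f z) \<le> 1"
    and axis: "\<And>x. norm x = 1 \<Longrightarrow> f (axis i x) = \<epsilon> * x" and \<epsilon>: "norm \<epsilon> = 1"
    and z: "z \<in> cpolydisc"
  shows "f z = \<epsilon> * z $ i"
proof -
  define w where "w = z - axis i (z $ i)"
  have w_nth: "w $ l = (if l = i then 0 else z $ l)" for l
    by (simp add: w_def axis_def)
  have in_cpolydisc: "axis i x + s *s w \<in> cpolydisc" if "norm x \<le> 1" "norm s \<le> 1" for x s
    using that z unfolding cpolydisc_def
    by (auto simp: w_nth axis_def norm_mult intro: mult_le_one)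
  have line_eq: "w + x *s axis i 1 = axis i x + w" for x
    by (simp add: vec_eq_iff axis_def)
  have line: "w + x *s axis i 1 \<in> cpolydisc" if "norm x \<le> 1" for x
    unfolding line_eq using in_cpolydisc[OF that, of 1] by simp
  define h where "h x = f (w + x *s axis i 1) - \<epsilon> * x" for x
  have boundary: "h x = 0" if x: "norm x = 1" for x
  proof -
    have "f (axis i x + w) = f (axis i x)"
      by (rule Aplus_constant_on_complex_line[OF f f_le])
         (use x in \<open>auto simp: in_cpolydisc axis \<epsilon> norm_mult\<close>)
    then show ?thesis
      unfolding h_def line_eq by (simp add: axis x)
  qed
  have "norm (h (z $ i)) \<le> 0"
  proof (rule maximum_modulus_frontier[of h "cball 0 1"])
    show "h holomorphic_on interior (cball 0 1)"
      unfolding h_def using holomorphic_on_Aplus_line[OF f line]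
      by (auto intro!: holomorphic_intros)
    show "continuous_on (closure (cball 0 1)) h"
      unfolding h_def using continuous_on_Aplus_line[OF f line]
      by (auto intro!: continuous_intros)
  qed (use boundary norm_nth_le_1[OF z] in auto)
  moreover have "w + (z $ i) *s axis i 1 = z"
    by (simp add: w_def vec_eq_iff axis_def)
  ultimately show ?thesis
    by (simp add: h_def)
qed

subsection \<open>Moebius functions and the Schwarz lemma\<close>

lemma Moebius_denominator_nonzero:
  assumes "norm a < 1" "norm z \<le> 1"
  shows "1 - cnj a * z \<noteq> 0"
proof
  assume "1 - cnj a * z = 0"
  then have "norm (cnj a * z) = 1" by simp
  moreover have "norm (cnj a * z) \<le> norm a"
    using assms by (simp add: norm_mult mult_right_le_one_le)
  ultimately show False using assms by simp
qed

lemma continuous_on_Moebius_function: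
  assumes "norm a < 1"
  shows "continuous_on (cball 0 1) (Moebius_function t a)"
  unfolding Moebius_function_def using Moebius_denominator_nonzero[OF assms]
  by (auto intro!: continuous_intros)

lemma Moebius_function_norm_eq_1:
  assumes "norm a < 1" "norm z = 1"
  shows "norm (Moebius_function t a z) = 1"
proof -
  have "z * cnj z = 1"
    using assms(2) by (simp flip: complex_norm_square)
  then have "1 - cnj a * z = z * cnj (z - a)"
    by (simp add: algebra_simps)
  then have "norm (1 - cnj a * z) = norm (z - a)"
    using assms(2) by (simp only: norm_mult complex_mod_cnj)
  then show ?thesis
    using Moebius_denominator_nonzero[of a z] assms
    by (auto simp: Moebius_function_def norm_divide norm_mult)
qed

lemma Moebius_function_holomorphic_compose:
  assumes "norm a < 1" "f holomorphic_on S" "\<And>x. x \<in> S \<Longrightarrow> norm (f x) < 1"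
  shows "(\<lambda>x. Moebius_function t a (f x)) holomorphic_on S"
  using holomorphic_on_compose_gen[OF assms(2) Moebius_function_holomorphic[OF assms(1)]] assms(3)
  by (auto simp: o_def image_subset_iff)

lemma Schwarz_Pick_eq_Moebius:
  assumes f: "f holomorphic_on ball 0 1" "\<And>x. norm x < 1 \<Longrightarrow> norm (f x) \<le> 1" "norm (f 0) < 1"
    and x: "norm x < 1" "x \<noteq> 0" "norm x \<le> norm (Moebius_function 0 (f 0) (f x))"
  obtains \<epsilon> where "norm \<epsilon> = 1"
    "\<And>y. norm y < 1 \<Longrightarrow> f y = Moebius_function 0 (- f 0) (\<epsilon> * y)"
proof -
  define g where "g y = Moebius_function 0 (f 0) (f y)" for y
  have f_less: "norm (f y) < 1" if "norm y < 1" for y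
    using holomorphic_norm_less_1[OF f(1,2) f(3) _ that] by simp
  have g_holomorphic: "g holomorphic_on ball 0 1"
    unfolding g_def by (rule Moebius_function_holomorphic_compose[OF f(3,1)]) (simp add: f_less)
  have g_0: "g 0 = 0"
    by (simp add: g_def Moebius_function_eq_zero)
  have g_less: "norm (g y) < 1" if "norm y < 1" for y
    unfolding g_def by (rule Moebius_function_norm_lt_1[OF f(3) f_less[OF that]])
  have "norm (g x) = norm x"
    using Schwarz_Lemma(1)[OF g_holomorphic g_0 g_less x(1)] x(3) by (simp add: g_def)
  then obtain \<epsilon> where \<epsilon>: "norm \<epsilon> = 1" "\<And>y. norm y < 1 \<Longrightarrow> g y = \<epsilon> * y"
    using Schwarz_Lemma(3)[OF g_holomorphic g_0 g_less x(1)] x(1,2) by blast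
  show ?thesis
  proof (rule that[OF \<epsilon>(1)])
    fix y :: complex
    assume y: "norm y < 1"
    have "f y = Moebius_function 0 (- f 0) (g y)"
      unfolding g_def using f(3) f_less[OF y] by (intro Moebius_function_compose[symmetric]) auto
    then show "f y = Moebius_function 0 (- f 0) (\<epsilon> * y)"
      by (simp add: \<epsilon>(2)[OF y])
  qed
qed

definition Moebius_disc :: "complex ^ 'n::finite \<Rightarrow> complex ^ 'n \<Rightarrow> complex \<Rightarrow> complex ^ 'n" where
  "Moebius_disc a v s = (\<chi> l. Moebius_function 0 (- (a $ l)) (s * v $ l))"

lemma Moebius_disc_0: "Moebius_disc a v 0 = a"
  by (simp add: Moebius_disc_def vec_eq_iff Moebius_function_of_zero)

lemma Schwarz_Moebius_disc:
  assumes g: "g \<in> Aplus" "\<And>z. z \<in> cpolydisc \<Longrightarrow> norm (g z) \<le> 1" "g a = 0"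
    and a: "a \<in> polydisc" and v: "v \<in> cpolydisc" and s: "norm s < 1"
  shows "norm (g (Moebius_disc a v s)) \<le> norm s"
proof -
  have a_less: "norm (- (a $ l)) < 1" for l
    using a by (simp add: polydisc_def)
  have arg_less: "norm (s * v $ l) < 1" if "norm s < 1" for s l
    using scale_in_polydisc[OF that v] by (simp add: polydisc_def)
  have in_cpolydisc: "Moebius_disc a v s \<in> cpolydisc" if "norm s < 1" for s
    unfolding Moebius_disc_def cpolydisc_def
    using Moebius_function_norm_lt_1[OF a_less arg_less[OF that]] by (simp add: less_imp_le)
  have holomorphic: "(\<lambda>s. g (Moebius_disc a v s)) holomorphic_on ball 0 1"
  proof (rule holomorphic_on_Aplus_compose[OF g(1)])
    show "(\<lambda>s. Moebius_disc a v s $ l) holomorphic_on ball 0 1" for l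
      unfolding Moebius_disc_def vec_lambda_beta using arg_less
      by (intro Moebius_function_holomorphic_compose a_less holomorphic_intros) auto
  qed (simp_all add: in_cpolydisc)
  show ?thesis
  proof (rule Schwarz_Lemma(1)[OF holomorphic _ _ s])
    show "norm (g (Moebius_disc a v t)) < 1" if "norm t < 1" for t
      by (rule holomorphic_norm_less_1[OF holomorphic, of 0])
         (use that in \<open>auto simp: in_cpolydisc g Moebius_disc_0\<close>)
  qed (simp add: g Moebius_disc_0)
qed

text \<open>The Moebius disc from \<open>a\<close> reaches \<open>w\<close> at the parameter that is the largest of the moduli on
  the right.\<close>
lemma Schwarz_Pick_polydisc:
  assumes g: "g \<in> Aplus" "\<And>z. z \<in> cpolydisc \<Longrightarrow> norm (g z) \<le> 1" "g a = 0"
    and a: "a \<in> polydisc" and w: "w \<in> polydisc"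
  obtains j where "norm (g w) \<le> norm (Moebius_function 0 (a $ j) (w $ j))"
proof -
  define m where "m l = Moebius_function 0 (a $ l) (w $ l)" for l
  have a_less: "norm (a $ l) < 1" and w_less: "norm (w $ l) < 1" for l
    using a w by (auto simp: polydisc_def)
  define r where "r = Max (range (\<lambda>l. norm (m l)))"
  have m_le: "norm (m l) \<le> r" for l
    unfolding r_def by (intro Max_ge) auto
  have "r \<in> range (\<lambda>l. norm (m l))"
    unfolding r_def by (rule Max_in) auto
  then obtain j where j: "r = norm (m j)"
    by auto
  have r: "0 \<le> r" "r < 1"
    unfolding j m_def using Moebius_function_norm_lt_1[OF a_less w_less] by auto
  define v where "v = (\<chi> l. m l / of_real r)"
  have "norm (m l / of_real r) \<le> 1" for l
    using m_le[of l] r(1) by (auto simp: norm_divide divide_le_eq_1)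
  then have "v \<in> cpolydisc"
    by (simp add: v_def cpolydisc_def)
  then have "norm (g (Moebius_disc a v (of_real r))) \<le> r"
    using Schwarz_Moebius_disc[OF g a, of v "of_real r"] r by simp
  moreover have "Moebius_disc a v (of_real r) = w"
  proof -
    have "of_real r * v $ l = m l" for l
      using m_le[of l] by (cases "r = 0") (auto simp: v_def)
    then show ?thesis
      using a_less w_less by (simp add: Moebius_disc_def vec_eq_iff m_def Moebius_function_compose)
  qed
  ultimately show ?thesis
    using that[of j] by (simp add: j m_def)
qed

section \<open>Power-bounded functions on the roots of unity\<close>

definition unity_roots :: "nat \<Rightarrow> complex set" where
  "unity_roots Q = {x. x ^ Q = 1}"

lemma finite_unity_roots: "Q > 0 \<Longrightarrow> finite (unity_roots Q)"
  by (simp add: unity_roots_def finite_roots_unity)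

lemma card_unity_roots: "Q > 0 \<Longrightarrow> card (unity_roots Q) = Q"
  by (simp add: unity_roots_def card_roots_unity_eq)

lemma unity_roots_mult: "x \<in> unity_roots Q \<Longrightarrow> y \<in> unity_roots Q \<Longrightarrow> x * y \<in> unity_roots Q"
  by (simp add: unity_roots_def power_mult_distrib)

lemma unity_roots_divide: "x \<in> unity_roots Q \<Longrightarrow> y \<in> unity_roots Q \<Longrightarrow> x / y \<in> unity_roots Q"
  by (simp add: unity_roots_def power_divide)

lemma norm_unity_roots:
  assumes "x \<in> unity_roots Q" "Q > 0"
  shows "norm x = 1"
proof -
  have "norm x ^ Q = 1"
    using assms(1) by (simp add: unity_roots_def flip: norm_power)
  then show ?thesis
    using assms(2) power_eq_iff_eq_base[of Q "norm x" 1] by simp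
qed

lemma mult_cnj_eq_1: "norm (x::complex) = 1 \<Longrightarrow> x * cnj x = 1"
  by (simp flip: complex_norm_square)

lemma mult_cnj_eq_1_iff:
  fixes a b :: complex
  assumes "norm b = 1"
  shows "a * cnj b = 1 \<longleftrightarrow> a = b"
proof -
  have "cnj b \<noteq> 0"
    using assms by auto
  then show ?thesis
    using mult_cnj_eq_1[OF assms] mult_right_cancel[of "cnj b" a b] by simp
qed

definition unity_dft :: "nat \<Rightarrow> (complex \<Rightarrow> complex) \<Rightarrow> nat \<Rightarrow> complex" where
  "unity_dft Q f l = (\<Sum>x\<in>unity_roots Q. x ^ l * cnj (f x))"

definition autocorrelation :: "nat \<Rightarrow> (complex \<Rightarrow> complex) \<Rightarrow> complex \<Rightarrow> complex" where
  "autocorrelation Q f u = (\<Sum>y\<in>unity_roots Q. cnj (f (u * y)) * f y)"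

lemma norm_unity_dft_squared:
  assumes "Q > 0"
  shows "complex_of_real ((norm (unity_dft Q f l))\<^sup>2) =
    (\<Sum>u\<in>unity_roots Q. u ^ l * autocorrelation Q f u)"
proof -
  let ?G = "unity_roots Q"
  have shift: "(\<Sum>x\<in>?G. x ^ l * cnj (f x) * (cnj y ^ l * f y)) =
      (\<Sum>u\<in>?G. u ^ l * (cnj (f (u * y)) * f y))" if y: "y \<in> ?G" for y
  proof -
    have y_unit: "y \<noteq> 0" "y * cnj y = 1"
      using norm_unity_roots[OF y assms] by (auto simp: mult_cnj_eq_1)
    have "(\<Sum>x\<in>?G. x ^ l * cnj (f x) * (cnj y ^ l * f y)) =
        (\<Sum>u\<in>?G. (u * y) ^ l * cnj (f (u * y)) * (cnj y ^ l * f y))"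
      using y y_unit(1) by (intro sum.reindex_bij_witness[of _ "\<lambda>u. u * y" "\<lambda>x. x / y"])
        (auto simp: unity_roots_mult unity_roots_divide)
    also have "\<dots> = (\<Sum>u\<in>?G. (y * cnj y) ^ l * (u ^ l * (cnj (f (u * y)) * f y)))"
      by (simp add: power_mult_distrib mult_ac)
    finally show ?thesis by (simp add: y_unit(2))
  qed
  have "complex_of_real ((norm (unity_dft Q f l))\<^sup>2) = unity_dft Q f l * cnj (unity_dft Q f l)"
    by (rule complex_norm_square)
  also have "\<dots> = (\<Sum>y\<in>?G. \<Sum>x\<in>?G. x ^ l * cnj (f x) * (cnj y ^ l * f y))"
    unfolding unity_dft_def cnj_sum sum_product by (subst sum.swap) simp
  also have "\<dots> = (\<Sum>y\<in>?G. \<Sum>u\<in>?G. u ^ l * (cnj (f (u * y)) * f y))"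
    by (rule sum.cong[OF refl shift])
  also have "\<dots> = (\<Sum>u\<in>?G. u ^ l * autocorrelation Q f u)"
    by (subst sum.swap) (simp add: autocorrelation_def sum_distrib_left)
  finally show ?thesis .
qed

lemma norm_unity_dft_power4_le:
  assumes "Q > 0"
  shows "norm (unity_dft Q f l) ^ 4 \<le> Q * (\<Sum>u\<in>unity_roots Q. (norm (autocorrelation Q f u))\<^sup>2)"
proof -
  have "(norm (unity_dft Q f l))\<^sup>2 = norm (\<Sum>u\<in>unity_roots Q. u ^ l * autocorrelation Q f u)"
    unfolding norm_unity_dft_squared[OF assms, symmetric] norm_of_real by simp
  also have "\<dots> \<le> (\<Sum>u\<in>unity_roots Q. norm (autocorrelation Q f u))"
    by (rule order_trans[OF norm_sum])
       (simp add: norm_mult norm_power norm_unity_roots[OF _ assms])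
  finally have "((norm (unity_dft Q f l))\<^sup>2)\<^sup>2 \<le>
      (\<Sum>u\<in>unity_roots Q. norm (autocorrelation Q f u))\<^sup>2"
    by (rule power_mono) simp
  also have "\<dots> \<le> Q * (\<Sum>u\<in>unity_roots Q. (norm (autocorrelation Q f u))\<^sup>2)"
    using sum_squared_le_sum_of_squares[of "\<lambda>u. norm (autocorrelation Q f u)" "unity_roots Q"]
    by (simp add: card_unity_roots[OF assms] mult.commute)
  finally show ?thesis
    by (simp flip: power_mult)
qed

lemma has_sum_sum:
  fixes f :: "'a \<Rightarrow> 'b \<Rightarrow> 'c::topological_comm_monoid_add"
  assumes "finite G" "\<And>x. x \<in> G \<Longrightarrow> ((\<lambda>k. f x k) has_sum s x) A"
  shows "((\<lambda>k. \<Sum>x\<in>G. f x k) has_sum (\<Sum>x\<in>G. s x)) A"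
  using assms by (induction rule: finite_induct) (auto intro: has_sum_add)

text \<open>By Parseval's identity the sum on the right is, up to normalisation, the sum of the fourth powers
  of the discrete Fourier coefficients of \<open>f\<close>.\<close>
lemma sum_autocorrelation_squared_ge:
  assumes Q: "Q > 0" and unimodular: "\<And>x. x \<in> unity_roots Q \<Longrightarrow> norm (f x) = 1"
    and series: "abs_power_series_on (unity_roots Q) f K"
  shows "real Q ^ 3 \<le> K ^ 4 * (\<Sum>u\<in>unity_roots Q. (norm (autocorrelation Q f u))\<^sup>2)"
proof -
  obtain c :: "nat \<Rightarrow> complex" where c: "c abs_summable_on UNIV" "(\<Sum>\<^sub>\<infinity>n. norm (c n)) \<le> K"
    and f: "\<forall>x\<in>unity_roots Q. ((\<lambda>n. c n * x ^ n) has_sum f x) UNIV"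
    using series unfolding abs_power_series_on_def by meson
  define W where "W = (\<Sum>u\<in>unity_roots Q. (norm (autocorrelation Q f u))\<^sup>2)"
  define R where "R = root 4 (Q * W)"
  have "W \<ge> 0"
    unfolding W_def by (intro sum_nonneg) auto
  then have R: "R ^ 4 = Q * W" "R \<ge> 0"
    by (auto simp: R_def)
  have dft_le: "norm (unity_dft Q f l) \<le> R" for l
  proof (rule power_le_imp_le_base)
    show "norm (unity_dft Q f l) ^ Suc 3 \<le> R ^ Suc 3"
      using norm_unity_dft_power4_le[OF Q, of f l] R(1) by (simp add: W_def)
  qed (rule R(2))
  have "((\<lambda>n. \<Sum>x\<in>unity_roots Q. c n * x ^ n * cnj (f x)) has_sum
      (\<Sum>x\<in>unity_roots Q. f x * cnj (f x))) UNIV"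
    by (intro has_sum_sum has_sum_cmult_left bspec[OF f] finite_unity_roots Q)
  also have "(\<Sum>x\<in>unity_roots Q. f x * cnj (f x)) = (\<Sum>x\<in>unity_roots Q. 1)"
    by (intro sum.cong refl mult_cnj_eq_1 unimodular)
  also have "\<dots> = of_nat Q"
    by (simp add: card_unity_roots Q)
  finally have "((\<lambda>n. c n * unity_dft Q f n) has_sum of_nat Q) UNIV"
    by (simp add: unity_dft_def sum_distrib_left mult.assoc)
  then have "norm (of_nat Q :: complex) \<le> (\<Sum>\<^sub>\<infinity>n. norm (c n)) * R"
    by (rule norm_infsum_le[OF _ has_sum_cmult_left[OF has_sum_infsum[OF c(1)]]])
       (simp add: norm_mult dft_le mult_left_mono)
  also have "\<dots> \<le> K * R"
    using R(2) c(2) by (intro mult_right_mono) auto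
  finally have "real Q ^ 4 \<le> (K * R) ^ 4"
    by (intro power_mono) auto
  then have "real Q * real Q ^ 3 \<le> real Q * (K ^ 4 * W)"
    by (simp add: power_mult_distrib R(1) mult_ac flip: power_Suc)
  then show ?thesis
    using Q by (simp add: W_def)
qed

lemma power_mean_tendsto:
  fixes w :: complex
  assumes "norm w = 1"
  shows "(\<lambda>N. (\<Sum>n<N. w ^ n) / of_nat N) \<longlonglongrightarrow> (if w = 1 then 1 else 0)"
proof (cases "w = 1")
  case True
  have "(\<lambda>N. of_nat N / of_nat N :: complex) \<longlonglongrightarrow> 1"
    by (rule tendsto_eventually) (auto simp: eventually_at_top_linorder intro!: exI[of _ 1])
  with True show ?thesis by simp
next
  case False
  have bound: "norm ((\<Sum>n<N. w ^ n) / of_nat N) \<le> 2 / norm (1 - w) * inverse (real N)" for N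
  proof -
    have "norm (1 - w ^ N) \<le> 2"
      using norm_triangle_ineq4[of 1 "w ^ N"] assms by (simp add: norm_power)
    then have "norm (1 - w ^ N) / norm (1 - w) * inverse (real N) \<le>
        2 / norm (1 - w) * inverse (real N)"
      by (intro mult_right_mono divide_right_mono) auto
    then show ?thesis
      using False by (simp add: sum_gp_strict norm_divide norm_mult norm_inverse divide_inverse)
  qed
  have "(\<lambda>N. 2 / norm (1 - w) * inverse (real N)) \<longlonglongrightarrow> 2 / norm (1 - w) * 0"
    by (intro tendsto_intros lim_inverse_n)
  then have "(\<lambda>N. (\<Sum>n<N. w ^ n) / of_nat N) \<longlonglongrightarrow> 0"
    by (intro Lim_null_comparison[OF always_eventually[OF allI[OF bound]]]) simp
  with False show ?thesis by simp
qed

lemma mean_power_sum_tendsto_card: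
  fixes w :: "'a \<Rightarrow> complex"
  assumes "finite T" "\<And>t. t \<in> T \<Longrightarrow> norm (w t) = 1"
  shows "(\<lambda>N. (\<Sum>n<N. \<Sum>t\<in>T. w t ^ n) / of_nat N) \<longlonglongrightarrow> of_nat (card {t \<in> T. w t = 1})"
proof -
  have "(\<lambda>N. \<Sum>t\<in>T. (\<Sum>n<N. w t ^ n) / of_nat N) \<longlonglongrightarrow> (\<Sum>t\<in>T. if w t = 1 then 1 else 0)"
    by (intro tendsto_sum power_mean_tendsto assms(2))
  also have "(\<Sum>t\<in>T. if w t = 1 then 1 else 0) = (of_nat (card {t \<in> T. w t = 1}) :: complex)"
    using assms(1) by (simp add: sum.If_cases Int_def)
  also have "(\<lambda>N. \<Sum>t\<in>T. (\<Sum>n<N. w t ^ n) / of_nat N) =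
      (\<lambda>N. (\<Sum>n<N. \<Sum>t\<in>T. w t ^ n) / of_nat N)"
    by (simp add: sum.swap[of _ T] flip: sum_divide_distrib)
  finally show ?thesis .
qed

definition energy_triples :: "nat \<Rightarrow> (complex \<Rightarrow> complex) \<Rightarrow> (complex \<times> complex \<times> complex) set" where
  "energy_triples Q f = {(u, y, v) \<in> unity_roots Q \<times> unity_roots Q \<times> unity_roots Q.
     f (u * y) * f v = f y * f (u * v)}"

lemma mean_autocorrelation_squared_tendsto:
  assumes Q: "Q > 0" and unimodular: "\<And>x. x \<in> unity_roots Q \<Longrightarrow> norm (f x) = 1"
  shows "(\<lambda>N. (\<Sum>n<N. \<Sum>u\<in>unity_roots Q. (norm (autocorrelation Q (\<lambda>x. f x ^ n) u))\<^sup>2) / real N)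
    \<longlonglongrightarrow> real (card (energy_triples Q f))"
proof -
  let ?G = "unity_roots Q"
  define T where "T = ?G \<times> ?G \<times> ?G"
  define w where "w = (\<lambda>(u, y, v). cnj (f (u * y)) * f y * (f (u * v) * cnj (f v)))"
  define W where "W n = (\<Sum>u\<in>?G. (norm (autocorrelation Q (\<lambda>x. f x ^ n) u))\<^sup>2)" for n
  have W: "complex_of_real (W n) = (\<Sum>t\<in>T. w t ^ n)" for n
  proof -
    have "complex_of_real (W n) = (\<Sum>u\<in>?G. \<Sum>y\<in>?G. \<Sum>v\<in>?G.
        cnj (f (u * y) ^ n) * f y ^ n * cnj (cnj (f (u * v) ^ n) * f v ^ n))"
      unfolding W_def autocorrelation_def of_real_sum complex_norm_square cnj_sum sum_product ..
    also have "\<dots> = (\<Sum>t\<in>T. w t ^ n)"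
      by (simp add: T_def w_def sum.cartesian_product power_mult_distrib case_prod_unfold)
    finally show ?thesis .
  qed
  have w_eq_1_iff: "w (u, y, v) = 1 \<longleftrightarrow> f (u * y) * f v = f y * f (u * v)"
    if "u \<in> ?G" "y \<in> ?G" "v \<in> ?G" for u y v
  proof -
    have w_eq: "w (u, y, v) = f y * f (u * v) * cnj (f (u * y) * f v)"
      by (simp add: w_def mult_ac)
    have "norm (f (u * y) * f v) = 1"
      using that by (simp add: norm_mult unimodular unity_roots_mult)
    then show ?thesis
      unfolding w_eq by (simp only: mult_cnj_eq_1_iff) (rule eq_commute)
  qed
  have "{t \<in> T. w t = 1} = energy_triples Q f"
    unfolding T_def energy_triples_def by (auto simp: w_eq_1_iff)
  moreover have "(\<lambda>N. (\<Sum>n<N. \<Sum>t\<in>T. w t ^ n) / of_nat N) \<longlonglongrightarrow> of_nat (card {t \<in> T. w t = 1})"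
    by (rule mean_power_sum_tendsto_card)
       (auto simp: T_def w_def norm_mult unimodular unity_roots_mult finite_unity_roots Q)
  ultimately have "(\<lambda>N. complex_of_real ((\<Sum>n<N. W n) / real N)) \<longlonglongrightarrow>
      complex_of_real (real (card (energy_triples Q f)))"
    by (simp add: W)
  then show ?thesis
    by (simp only: tendsto_of_real_iff W_def)
qed

lemma card_energy_triples_ge:
  assumes Q: "Q > 0" and unimodular: "\<And>x. x \<in> unity_roots Q \<Longrightarrow> norm (f x) = 1"
    and series: "\<And>n. abs_power_series_on (unity_roots Q) (\<lambda>x. f x ^ n) K"
  shows "real Q ^ 3 \<le> K ^ 4 * real (card (energy_triples Q f))"
proof -
  define W where "W n = (\<Sum>u\<in>unity_roots Q. (norm (autocorrelation Q (\<lambda>x. f x ^ n) u))\<^sup>2)" for n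
  have lower: "real Q ^ 3 \<le> K ^ 4 * W n" for n
    unfolding W_def by (rule sum_autocorrelation_squared_ge[OF Q _ series])
      (simp add: norm_power unimodular)
  have limit: "(\<lambda>N. (\<Sum>n<N. W n) / real N) \<longlonglongrightarrow> real (card (energy_triples Q f))"
    unfolding W_def by (rule mean_autocorrelation_squared_tendsto[OF Q unimodular])
  show ?thesis
  proof (rule LIMSEQ_le_const[OF tendsto_mult_left[OF limit]], intro exI allI impI)
    fix N :: nat
    assume N: "1 \<le> N"
    have "real N * real Q ^ 3 \<le> (\<Sum>n<N. K ^ 4 * W n)"
      using sum_mono[of "{..<N}" "\<lambda>_. real Q ^ 3", OF lower] by simp
    then show "real Q ^ 3 \<le> K ^ 4 * ((\<Sum>n<N. W n) / real N)"
      using N by (simp add: field_simps flip: sum_distrib_left sum_distrib_right)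
  qed
qed

subsection \<open>Moebius maps that are not rotations\<close>

text \<open>With the product \<open>x y\<close> held fixed, the product of the values at \<open>x\<close> and \<open>y\<close> is a fractional
  linear function of \<open>x + y\<close>, and it degenerates only if \<open>cnj a * (x * y) = a\<close>.\<close>
lemma Moebius_function_mult_eq_cases:
  assumes a: "norm a < 1" and unit: "norm x = 1" "norm y = 1" "norm z = 1" "norm w = 1"
    and prod_eq: "x * y = z * w"
    and eq: "Moebius_function 0 a x * Moebius_function 0 a y =
      Moebius_function 0 a z * Moebius_function 0 a w"
  shows "x = z \<or> x = w \<or> cnj a * (x * y) = a"
proof -
  define p s t where "p = x * y" and "s = x + y" and "t = z + w"
  have nonzero: "1 - cnj a * x \<noteq> 0" "1 - cnj a * y \<noteq> 0" "1 - cnj a * z \<noteq> 0" "1 - cnj a * w \<noteq> 0"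
    "1 - cnj a * a \<noteq> 0"
    by (rule Moebius_denominator_nonzero; use a unit in simp)+
  have "((x - a) * (y - a)) * ((1 - cnj a * z) * (1 - cnj a * w)) =
      ((z - a) * (w - a)) * ((1 - cnj a * x) * (1 - cnj a * y))"
    using eq nonzero(1-4) by (simp add: Moebius_function_simple frac_eq_eq)
  moreover have "(x - a) * (y - a) = p - a * s + a * a" "(z - a) * (w - a) = p - a * t + a * a"
    "(1 - cnj a * z) * (1 - cnj a * w) = 1 - cnj a * t + cnj a * cnj a * p"
    "(1 - cnj a * x) * (1 - cnj a * y) = 1 - cnj a * s + cnj a * cnj a * p"
    using prod_eq by (auto simp: p_def s_def t_def algebra_simps)
  ultimately have "(p - a * s + a * a) * (1 - cnj a * t + cnj a * cnj a * p) =
      (p - a * t + a * a) * (1 - cnj a * s + cnj a * cnj a * p)"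
    by simp
  then have "(s - t) * ((1 - cnj a * a) * (cnj a * p - a)) = 0"
    by (simp add: algebra_simps)
  then have "s = t \<or> cnj a * p = a"
    using nonzero(5) by simp
  moreover have "x = z \<or> x = w" if "s = t"
  proof -
    have "(x - z) * (x - w) = x * x - x * t + z * w"
      by (simp add: t_def algebra_simps)
    also have "\<dots> = x * x - x * s + p"
      using that prod_eq by (simp add: p_def)
    also have "\<dots> = 0"
      by (simp add: s_def p_def algebra_simps)
    finally show ?thesis by simp
  qed
  ultimately show ?thesis by (auto simp: p_def)
qed

lemma energy_triples_Moebius_cases:
  assumes a: "norm a < 1" "a \<noteq> 0" and \<epsilon>: "norm \<epsilon> = 1" and Q: "Q > 0"
    and triple: "(u, y, v) \<in> energy_triples Q (\<lambda>x. Moebius_function 0 a (\<epsilon> * x))"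
  shows "u = 1 \<or> v = y \<or> v = a / (cnj a * (\<epsilon>\<^sup>2 * u * y))"
proof -
  have unit: "norm u = 1" "norm y = 1" "norm v = 1"
    and eq: "Moebius_function 0 a (\<epsilon> * (u * y)) * Moebius_function 0 a (\<epsilon> * v) =
      Moebius_function 0 a (\<epsilon> * y) * Moebius_function 0 a (\<epsilon> * (u * v))"
    using triple by (simp_all add: energy_triples_def norm_unity_roots[OF _ Q])
  from unit have nonzero: "\<epsilon> \<noteq> 0" "u \<noteq> 0" "y \<noteq> 0"
    using \<epsilon> by auto
  have "\<epsilon> * (u * y) = \<epsilon> * y \<or> \<epsilon> * (u * y) = \<epsilon> * (u * v) \<or>
      cnj a * (\<epsilon> * (u * y) * (\<epsilon> * v)) = a"
    by (rule Moebius_function_mult_eq_cases[OF a(1) _ _ _ _ _ eq])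
       (simp_all add: norm_mult unit \<epsilon> mult_ac)
  then show ?thesis
    using nonzero a(2) by (auto simp: field_simps power2_eq_square)
qed

lemma card_energy_triples_Moebius_le:
  assumes a: "norm a < 1" "a \<noteq> 0" and \<epsilon>: "norm \<epsilon> = 1" and Q: "Q > 0"
  shows "card (energy_triples Q (\<lambda>x. Moebius_function 0 a (\<epsilon> * x))) \<le> 3 * Q\<^sup>2"
proof -
  let ?G = "unity_roots Q"
  define E1 E2 E3 where "E1 = {1::complex} \<times> ?G \<times> ?G"
    and "E2 = (\<lambda>(u, y). (u, y, y)) ` (?G \<times> ?G)"
    and "E3 = (\<lambda>(u, y). (u, y, a / (cnj a * (\<epsilon>\<^sup>2 * u * y)))) ` (?G \<times> ?G)"
  have finite: "finite (?G \<times> ?G)"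
    by (simp add: finite_unity_roots Q)
  have "energy_triples Q (\<lambda>x. Moebius_function 0 a (\<epsilon> * x)) \<subseteq> E1 \<union> (E2 \<union> E3)"
  proof
    fix t
    assume t_in: "t \<in> energy_triples Q (\<lambda>x. Moebius_function 0 a (\<epsilon> * x))"
    then obtain u y v where t: "t = (u, y, v)" and uyv: "u \<in> ?G" "y \<in> ?G" "v \<in> ?G"
      unfolding energy_triples_def by blast
    consider "u = 1" | "v = y" | "v = a / (cnj a * (\<epsilon>\<^sup>2 * u * y))"
      using energy_triples_Moebius_cases[OF a \<epsilon> Q t_in[unfolded t]] by blast
    then show "t \<in> E1 \<union> (E2 \<union> E3)"
      using uyv by cases (auto simp: t E1_def E2_def E3_def)
  qed
  then have "card (energy_triples Q (\<lambda>x. Moebius_function 0 a (\<epsilon> * x))) \<le> card (E1 \<union> (E2 \<union> E3))"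
    by (rule card_mono[rotated]) (auto simp: E1_def E2_def E3_def finite_unity_roots Q)
  also have "\<dots> \<le> card E1 + (card E2 + card E3)"
    by (rule order_trans[OF card_Un_le add_left_mono[OF card_Un_le]])
  also have "\<dots> \<le> card (?G \<times> ?G) + (card (?G \<times> ?G) + card (?G \<times> ?G))"
    unfolding E1_def E2_def E3_def
    by (intro add_mono card_image_le finite) (simp add: card_cartesian_product)
  also have "\<dots> = 3 * Q\<^sup>2"
    by (simp add: card_cartesian_product card_unity_roots Q power2_eq_square)
  finally show ?thesis .
qed

lemma Moebius_powers_bounded_imp_zero:
  assumes a: "norm a < 1" and \<epsilon>: "norm \<epsilon> = 1"
    and series: "\<And>n. abs_power_series_on (sphere 0 1) (\<lambda>x. Moebius_function 0 a (\<epsilon> * x) ^ n) K"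
  shows "a = 0"
proof (rule ccontr)
  assume "a \<noteq> 0"
  obtain Q :: nat where Q: "real Q > 3 * K ^ 4" "Q > 0"
    using reals_Archimedean2[of "max 1 (3 * K ^ 4)"] by auto
  define f where "f x = Moebius_function 0 a (\<epsilon> * x)" for x
  have unit: "norm x = 1" if "x \<in> unity_roots Q" for x
    using norm_unity_roots[OF that Q(2)] .
  have "abs_power_series_on (unity_roots Q) (\<lambda>x. f x ^ n) K" for n
    unfolding f_def by (rule abs_power_series_on_subset[OF series]) (auto simp: unit)
  moreover have "norm (f x) = 1" if "x \<in> unity_roots Q" for x
    unfolding f_def by (rule Moebius_function_norm_eq_1[OF a]) (simp add: norm_mult \<epsilon> unit that)
  ultimately have "real Q ^ 3 \<le> K ^ 4 * real (card (energy_triples Q f))"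
    by (intro card_energy_triples_ge[OF Q(2)])
  also have "\<dots> \<le> K ^ 4 * real (3 * Q\<^sup>2)"
    unfolding f_def
    by (intro mult_left_mono of_nat_mono card_energy_triples_Moebius_le a \<open>a \<noteq> 0\<close> \<epsilon> Q(2)) simp
  finally have "(real Q)\<^sup>2 * real Q \<le> (real Q)\<^sup>2 * (3 * K ^ 4)"
    by (simp add: power3_eq_cube power2_eq_square algebra_simps)
  then have "real Q \<le> 3 * K ^ 4"
    using Q(2) by simp
  with Q(1) show False by simp
qed

section \<open>Composition operators\<close>

lemma comp_op_eqI:
  assumes "g \<in> Aplus" "\<And>z. z \<in> polydisc \<Longrightarrow> g z = f (\<phi> z)"
  shows "comp_op \<phi> f = g"
  unfolding comp_op_def
  by (rule the_equality) (use assms in \<open>auto intro: Aplus_eqI\<close>)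

lemma
  assumes "comp_op_bounded \<phi>" "f \<in> Aplus"
  shows comp_op_in_Aplus: "comp_op \<phi> f \<in> Aplus"
    and comp_op_apply: "z \<in> polydisc \<Longrightarrow> comp_op \<phi> f z = f (\<phi> z)"
proof -
  obtain g where g: "g \<in> Aplus" "\<forall>z\<in>polydisc. g z = f (\<phi> z)"
    using assms by (auto simp: comp_op_bounded_def)
  then have "comp_op \<phi> f = g" by (intro comp_op_eqI) auto
  with g show "comp_op \<phi> f \<in> Aplus" "z \<in> polydisc \<Longrightarrow> comp_op \<phi> f z = f (\<phi> z)" by auto
qed

lemma comp_op_bounded_coord_pow:
  assumes "comp_op_bounded \<phi>"
  obtains K where "\<And>i n. Aplus_norm (comp_op \<phi> (coord_pow i n)) < K"
proof -
  obtain C where C: "\<And>f. f \<in> Aplus \<Longrightarrow> Aplus_norm (comp_op \<phi> f) \<le> C * Aplus_norm f"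
    using assms by (auto simp: comp_op_bounded_def)
  have "Aplus_norm (comp_op \<phi> (coord_pow i n)) < \<bar>C\<bar> + 1" for i n
  proof -
    have "Aplus_norm (comp_op \<phi> (coord_pow i n)) \<le> C * Aplus_norm (coord_pow i n)"
      by (rule C) simp
    also have "\<dots> \<le> \<bar>C\<bar> * 1"
      by (intro mult_mono Aplus_norm_coord_pow_le_1) (auto intro: Aplus_norm_nonneg)
    finally show ?thesis by simp
  qed
  then show ?thesis by (rule that)
qed

subsection \<open>Rotations of the coordinates\<close>

definition coord_rotation ::
    "('n \<Rightarrow> 'n) \<Rightarrow> ('n \<Rightarrow> complex) \<Rightarrow> complex ^ 'n::finite \<Rightarrow> complex ^ 'n" where
  "coord_rotation \<sigma> \<epsilon> z = (\<chi> i. \<epsilon> i * z $ \<sigma> i)"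

lemma coord_rotation_in_cpolydisc_iff:
  assumes "\<sigma> permutes UNIV" "\<And>i. norm (\<epsilon> i) = 1"
  shows "coord_rotation \<sigma> \<epsilon> z \<in> cpolydisc \<longleftrightarrow> z \<in> cpolydisc"
  unfolding cpolydisc_def coord_rotation_def
  by (simp add: norm_mult assms(2)) (metis assms(1) permutes_inverses(1))

lemma coord_rotation_inverse:
  assumes "\<sigma> permutes UNIV" "\<And>i. \<epsilon> i \<noteq> 0"
  shows "coord_rotation \<sigma> \<epsilon> (coord_rotation (inv \<sigma>) (\<lambda>i. inverse (\<epsilon> (inv \<sigma> i))) z) = z"
    and "coord_rotation (inv \<sigma>) (\<lambda>i. inverse (\<epsilon> (inv \<sigma> i))) (coord_rotation \<sigma> \<epsilon> z) = z"
  by (simp_all add: coord_rotation_def vec_eq_iff permutes_inverses[OF assms(1)] assms(2))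

lemma monomial_pow_coord_rotation:
  assumes "\<sigma> permutes UNIV"
  shows "monomial_pow m (coord_rotation \<sigma> \<epsilon> z) =
    (\<Prod>i\<in>UNIV. \<epsilon> i ^ m i) * monomial_pow (m \<circ> inv \<sigma>) z"
proof -
  have "(\<Prod>i\<in>UNIV. (z $ \<sigma> i) ^ m i) = (\<Prod>i\<in>UNIV. (z $ i) ^ m (inv \<sigma> i))"
    using prod.permute[OF assms, of "\<lambda>i. (z $ i) ^ m (inv \<sigma> i)"]
    by (simp add: o_def permutes_inverses[OF assms])
  then show ?thesis
    by (simp add: monomial_pow_def coord_rotation_def power_mult_distrib prod.distrib)
qed

lemma Aplus_compose_coord_rotation:
  assumes f: "f \<in> Aplus" and \<sigma>: "\<sigma> permutes UNIV" and \<epsilon>: "\<And>i. norm (\<epsilon> i) = 1"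
  shows "(\<lambda>z. f (coord_rotation \<sigma> \<epsilon> z)) \<in> Aplus"
proof -
  obtain a where a: "represents a f"
    using f by (rule AplusE)
  show ?thesis
  proof (rule Aplus_familyI[where c = "\<lambda>m. a m * (\<Prod>i\<in>UNIV. \<epsilon> i ^ m i)" and d = "\<lambda>m. m \<circ> inv \<sigma>"])
    show "(\<lambda>m. a m * (\<Prod>i\<in>UNIV. \<epsilon> i ^ m i)) abs_summable_on UNIV"
      using represents_abs_summable[OF a] by (simp add: norm_mult norm_power \<epsilon> flip: prod_norm)
    show "((\<lambda>m. a m * (\<Prod>i\<in>UNIV. \<epsilon> i ^ m i) * monomial_pow (m \<circ> inv \<sigma>) z) has_sum
        f (coord_rotation \<sigma> \<epsilon> z)) UNIV" if "z \<in> cpolydisc" for z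
      using represents_has_sum[OF a, of "coord_rotation \<sigma> \<epsilon> z"] that
      by (simp add: coord_rotation_in_cpolydisc_iff[OF \<sigma> \<epsilon>] monomial_pow_coord_rotation[OF \<sigma>]
          mult.assoc)
  qed (simp add: Aplus_outside[OF f] coord_rotation_in_cpolydisc_iff[OF \<sigma> \<epsilon>])
qed

lemma coord_rotation_imp_automorphism:
  assumes \<sigma>: "\<sigma> permutes UNIV" and \<epsilon>: "\<And>i. norm (\<epsilon> i) = 1"
    and \<phi>: "\<And>z. z \<in> polydisc \<Longrightarrow> \<phi> z = coord_rotation \<sigma> \<epsilon> z"
  shows "Aplus_automorphism (comp_op \<phi>)"
proof -
  define inverse_rotation where
    "inverse_rotation = coord_rotation (inv \<sigma>) (\<lambda>i. inverse (\<epsilon> (inv \<sigma> i)))"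
  have nonzero: "\<epsilon> i \<noteq> 0" for i
    using \<epsilon>[of i] by auto
  have inverse: "coord_rotation \<sigma> \<epsilon> (inverse_rotation z) = z"
    "inverse_rotation (coord_rotation \<sigma> \<epsilon> z) = z" for z
    unfolding inverse_rotation_def by (rule coord_rotation_inverse[OF \<sigma> nonzero])+
  have compose: "(\<lambda>z. f (coord_rotation \<sigma> \<epsilon> z)) \<in> Aplus" if "f \<in> Aplus" for f
    by (rule Aplus_compose_coord_rotation[OF that \<sigma> \<epsilon>])
  have compose_inverse: "(\<lambda>z. f (inverse_rotation z)) \<in> Aplus" if "f \<in> Aplus" for f
    unfolding inverse_rotation_def
    by (rule Aplus_compose_coord_rotation[OF that permutes_inv[OF \<sigma>]]) (simp add: norm_inverse \<epsilon>)
  have comp_op_eq: "comp_op \<phi> f = (\<lambda>z. f (coord_rotation \<sigma> \<epsilon> z))" if "f \<in> Aplus" for f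
    by (rule comp_op_eqI[OF compose[OF that]]) (simp add: \<phi>)
  have "bij_betw (comp_op \<phi>) Aplus Aplus"
    by (rule bij_betwI[where g = "\<lambda>f z. f (inverse_rotation z)"])
       (auto simp: comp_op_eq compose compose_inverse inverse)
  moreover have "comp_op \<phi> Aplus_one = Aplus_one"
    by (simp add: comp_op_eq fun_eq_iff Aplus_one_def coord_rotation_in_cpolydisc_iff[OF \<sigma> \<epsilon>])
  ultimately show ?thesis
    by (simp add: Aplus_automorphism_def comp_op_eq Aplus_add Aplus_cmult Aplus_mult)
qed

section \<open>Automorphisms\<close>

lemma
  assumes "Aplus_automorphism T"
  shows Aplus_automorphism_bij: "bij_betw T Aplus Aplus"
    and Aplus_automorphism_add:
      "f \<in> Aplus \<Longrightarrow> g \<in> Aplus \<Longrightarrow> T (\<lambda>z. f z + g z) = (\<lambda>z. T f z + T g z)"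
    and Aplus_automorphism_cmult: "f \<in> Aplus \<Longrightarrow> T (\<lambda>z. c * f z) = (\<lambda>z. c * T f z)"
    and Aplus_automorphism_mult:
      "f \<in> Aplus \<Longrightarrow> g \<in> Aplus \<Longrightarrow> T (\<lambda>z. f z * g z) = (\<lambda>z. T f z * T g z)"
    and Aplus_automorphism_one: "T Aplus_one = Aplus_one"
  using assms by (simp_all add: Aplus_automorphism_def)

lemma Aplus_automorphism_surjE:
  assumes "Aplus_automorphism T" "h \<in> Aplus"
  obtains k where "k \<in> Aplus" "T k = h"
proof -
  have "h \<in> T ` Aplus"
    using bij_betw_imp_surj_on[OF Aplus_automorphism_bij[OF assms(1)]] assms(2) by simp
  then show ?thesis
    using that by blast
qed

lemma Aplus_automorphism_inject:
  assumes "Aplus_automorphism T" "f \<in> Aplus" "g \<in> Aplus" "T f = T g"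
  shows "f = g"
  by (rule inj_onD[OF bij_betw_imp_inj_on[OF Aplus_automorphism_bij[OF assms(1)]] assms(4,2,3)])

lemma Aplus_automorphism_reflects_units:
  assumes aut: "Aplus_automorphism T" and g: "g \<in> Aplus"
    and unit: "h \<in> Aplus" "(\<lambda>z. T g z * h z) = Aplus_one"
  obtains k where "k \<in> Aplus" "(\<lambda>z. g z * k z) = Aplus_one"
proof -
  obtain k where k: "k \<in> Aplus" "T k = h"
    by (rule Aplus_automorphism_surjE[OF aut unit(1)])
  have "T (\<lambda>z. g z * k z) = T Aplus_one"
    by (simp add: Aplus_automorphism_mult[OF aut g k(1)] Aplus_automorphism_one[OF aut] k(2) unit(2))
  then have "(\<lambda>z. g z * k z) = Aplus_one"
    by (rule Aplus_automorphism_inject[OF aut Aplus_mult[OF g k(1)] Aplus_one_in_Aplus])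
  with k(1) show ?thesis by (rule that)
qed

lemma Aplus_automorphism_coord_preimage_le_1:
  assumes aut: "Aplus_automorphism T" and g: "g \<in> Aplus" "T g = coord_pow i 1"
    and w: "w \<in> cpolydisc"
  shows "norm (g w) \<le> 1"
proof (rule ccontr)
  assume "\<not> norm (g w) \<le> 1"
  then obtain h where h: "h \<in> Aplus"
    "(\<lambda>z. (g w * Aplus_one z - coord_pow i 1 z) * h z) = Aplus_one"
    using Aplus_resolvent[of "g w" i] by auto
  define f where "f = (\<lambda>z. g w * Aplus_one z + (- 1) * g z)"
  have f: "f \<in> Aplus"
    unfolding f_def by (intro Aplus_add Aplus_cmult Aplus_one_in_Aplus g(1))
  have "T f = (\<lambda>z. g w * T Aplus_one z + (- 1) * T g z)"
    unfolding f_def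
      Aplus_automorphism_add[OF aut Aplus_cmult[OF Aplus_one_in_Aplus] Aplus_cmult[OF g(1)]]
      Aplus_automorphism_cmult[OF aut Aplus_one_in_Aplus] Aplus_automorphism_cmult[OF aut g(1)] ..
  then have "(\<lambda>z. T f z * h z) = Aplus_one"
    using h(2) by (simp add: Aplus_automorphism_one[OF aut] g(2))
  then obtain k where "(\<lambda>z. f z * k z) = Aplus_one"
    by (rule Aplus_automorphism_reflects_units[OF aut f h(1)])
  from fun_cong[OF this, of w] show False
    using w by (simp add: f_def Aplus_one_def)
qed

lemma Aplus_automorphism_coord_pow:
  assumes aut: "Aplus_automorphism T" and z: "z \<in> cpolydisc"
  shows "T (coord_pow i n) z = T (coord_pow i 1) z ^ n"
proof (induction n)
  case 0
  have "T (coord_pow i 0) z = 1"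
    unfolding coord_pow_0 Aplus_automorphism_one[OF aut] using z by (simp add: Aplus_one_def)
  then show ?case by simp
next
  case (Suc n)
  have "T (coord_pow i (Suc n)) = (\<lambda>z. T (coord_pow i 1) z * T (coord_pow i n) z)"
    unfolding coord_pow_Suc[of i n] by (rule Aplus_automorphism_mult[OF aut]) simp_all
  then show ?case
    by (simp add: Suc.IH)
qed

locale composition_automorphism =
  fixes \<phi> :: "complex ^ 'n::finite \<Rightarrow> complex ^ 'n"
  assumes maps: "z \<in> polydisc \<Longrightarrow> \<phi> z \<in> cpolydisc"
    and bounded: "comp_op_bounded \<phi>"
    and automorphism: "Aplus_automorphism (comp_op \<phi>)"
begin

text \<open>The values of \<open>\<phi>\<close> outside the open polydisc are arbitrary; this extends \<open>\<phi>\<^sub>j\<close> continuously to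
  the closed one.\<close>
definition component :: "'n \<Rightarrow> complex ^ 'n \<Rightarrow> complex" where
  "component j = comp_op \<phi> (coord_pow j 1)"

lemma component_in_Aplus: "component j \<in> Aplus"
  unfolding component_def by (rule comp_op_in_Aplus[OF bounded]) simp

lemma component_eq: "z \<in> polydisc \<Longrightarrow> component j z = \<phi> z $ j"
  by (simp add: component_def comp_op_apply[OF bounded] coord_pow_def maps)

lemma norm_component_le_1:
  assumes "z \<in> cpolydisc"
  shows "norm (component j z) \<le> 1"
proof (rule Aplus_norm_le_1_on_closure[OF component_in_Aplus _ assms])
  show "norm (component j w) \<le> 1" if "w \<in> polydisc" for w
    using norm_nth_le_1[OF maps[OF that]] by (simp add: component_eq that)
qed

lemma component_not_constant: "\<not> (\<forall>z\<in>polydisc. component j z = c)"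
proof
  assume const: "\<forall>z\<in>polydisc. component j z = c"
  have c_one: "(\<lambda>z. c * Aplus_one z) \<in> Aplus"
    by (rule Aplus_cmult[OF Aplus_one_in_Aplus])
  have "comp_op \<phi> (\<lambda>z. c * Aplus_one z) = component j"
    by (rule comp_op_eqI[OF component_in_Aplus]) (simp add: const Aplus_one_def maps)
  then have "coord_pow j 1 = (\<lambda>z. c * Aplus_one z)"
    unfolding component_def
    by (intro Aplus_automorphism_inject[OF automorphism coord_pow_in_Aplus c_one]) simp
  then have "coord_pow j 1 w = c" if "w \<in> cpolydisc" for w
    using that by (simp add: Aplus_one_def)
  from this[of 0] this[of "axis j 1"] show False
    by (simp add: coord_pow_def polydisc_imp_cpolydisc)
qed

lemma zero_image_in_polydisc: "\<phi> 0 \<in> polydisc"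
proof -
  have "norm (component j 0) \<noteq> 1" for j
    using Aplus_constant_if_unimodular_at_0[OF component_in_Aplus norm_component_le_1]
      component_not_constant polydisc_imp_cpolydisc by metis
  then have "norm (component j 0) < 1" for j
    using norm_component_le_1[OF polydisc_imp_cpolydisc[OF zero_in_polydisc]] order_le_neq_trans
    by blast
  then show ?thesis
    by (simp add: polydisc_def component_eq)
qed

lemma component_axis_holomorphic: "(\<lambda>x. component j (axis i x)) holomorphic_on ball 0 1"
  by (rule holomorphic_on_Aplus_compose[OF component_in_Aplus]) (auto simp: holomorphic_on_axis_nth)

lemma axis_image_in_polydisc:
  assumes "norm x < 1"
  shows "\<phi> (axis i x) \<in> polydisc"
proof -
  have at_0: "norm (component j (axis i 0)) < 1" for j
    using zero_image_in_polydisc by (simp add: component_eq polydisc_def)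
  have "norm (component j (axis i x)) < 1" for j
    by (rule holomorphic_norm_less_1[OF component_axis_holomorphic _ at_0 _ assms])
       (simp_all add: norm_component_le_1)
  then have "norm (\<phi> (axis i x) $ j) < 1" for j
    using assms by (simp add: component_eq)
  then show ?thesis
    by (simp add: polydisc_def)
qed

lemma left_inverse:
  obtains g where "g \<in> Aplus" "\<And>w. w \<in> cpolydisc \<Longrightarrow> norm (g w) \<le> 1"
    and "\<And>z. z \<in> polydisc \<Longrightarrow> g (\<phi> z) = z $ i"
proof -
  obtain g where g: "g \<in> Aplus" "comp_op \<phi> g = coord_pow i 1"
    by (rule Aplus_automorphism_surjE[OF automorphism coord_pow_in_Aplus])
  show ?thesis
  proof
    show "g \<in> Aplus" by (rule g(1))
    show "norm (g w) \<le> 1" if "w \<in> cpolydisc" for w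
      by (rule Aplus_automorphism_coord_preimage_le_1[OF automorphism g that])
    show "g (\<phi> z) = z $ i" if "z \<in> polydisc" for z
      using comp_op_apply[OF bounded g(1) that] that
      by (simp add: g(2) coord_pow_def polydisc_imp_cpolydisc)
  qed
qed

text \<open>Normalised so that they fix 0, both \<open>\<phi>\<close> and its left inverse are contractions for the sup norm,
  and the left inverse takes \<open>\<phi> (axis i (1/2))\<close> back to \<open>1/2\<close>. Hence some component of \<open>\<phi>\<close> attains
  equality in the Schwarz lemma there.\<close>
lemma component_Moebius_on_open_axis:
  "\<exists>j \<epsilon>. norm \<epsilon> = 1 \<and>
    (\<forall>x. norm x < 1 \<longrightarrow> component j (axis i x) = Moebius_function 0 (- (\<phi> 0 $ j)) (\<epsilon> * x))"
proof -
  obtain g where g: "g \<in> Aplus" "\<And>w. w \<in> cpolydisc \<Longrightarrow> norm (g w) \<le> 1"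
    and inverse: "\<And>z. z \<in> polydisc \<Longrightarrow> g (\<phi> z) = z $ i"
    using left_inverse[of i] by blast
  have at_0: "component j 0 = \<phi> 0 $ j" for j
    by (simp add: component_eq)
  have "g (\<phi> 0) = 0"
    using inverse[of 0] by simp
  then obtain j where "norm (g (\<phi> (axis i (1/2)))) \<le>
      norm (Moebius_function 0 (\<phi> 0 $ j) (\<phi> (axis i (1/2)) $ j))"
    using Schwarz_Pick_polydisc[OF g _ zero_image_in_polydisc axis_image_in_polydisc, of "1/2" i]
    by auto
  then have extremal: "norm (1/2 :: complex) \<le> norm (Moebius_function 0
      (component j (axis i 0)) (component j (axis i (1/2))))"
    by (simp add: inverse at_0 component_eq)
  show ?thesis
  proof (rule Schwarz_Pick_eq_Moebius[OF component_axis_holomorphic _ _ _ _ extremal])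
    show "norm (component j (axis i x)) \<le> 1" if "norm x < 1" for x
      using that by (simp add: norm_component_le_1)
    show "norm (component j (axis i 0)) < 1"
      using zero_image_in_polydisc by (simp add: component_eq polydisc_def)
    show ?thesis if "norm \<epsilon> = 1" and "\<And>x. norm x < 1 \<Longrightarrow> component j (axis i x) =
        Moebius_function 0 (- component j (axis i 0)) (\<epsilon> * x)" for \<epsilon>
      using that by (intro exI[of _ j] exI[of _ \<epsilon>]) (simp add: at_0)
  qed simp_all
qed

lemma component_Moebius_on_axis:
  "\<exists>j \<epsilon>. norm \<epsilon> = 1 \<and>
    (\<forall>x. norm x \<le> 1 \<longrightarrow> component j (axis i x) = Moebius_function 0 (- (\<phi> 0 $ j)) (\<epsilon> * x))"
proof -
  obtain j \<epsilon> where \<epsilon>: "norm \<epsilon> = 1" and interior: "\<And>x. norm x < 1 \<Longrightarrow>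
      component j (axis i x) = Moebius_function 0 (- (\<phi> 0 $ j)) (\<epsilon> * x)"
    using component_Moebius_on_open_axis[of i] by blast
  define D where "D x = component j (axis i x) - Moebius_function 0 (- (\<phi> 0 $ j)) (\<epsilon> * x)" for x
  have "norm (- (\<phi> 0 $ j)) < 1"
    using zero_image_in_polydisc by (simp add: polydisc_def)
  then have "continuous_on (cball 0 1) (\<lambda>x. Moebius_function 0 (- (\<phi> 0 $ j)) (\<epsilon> * x))"
    by (intro continuous_on_compose2[OF continuous_on_Moebius_function] continuous_intros)
       (auto simp: norm_mult \<epsilon>)
  moreover have "continuous_on (cball 0 1) (\<lambda>x. component j (axis i x))"
    by (intro continuous_on_Aplus_compose[OF component_in_Aplus] continuous_intros) simp
  ultimately have continuous: "continuous_on (closure (ball 0 1)) D"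
    unfolding D_def by (simp add: continuous_on_diff)
  show ?thesis
  proof (intro exI[of _ j] exI[of _ \<epsilon>] conjI allI impI \<epsilon>)
    fix x :: complex
    assume x: "norm x \<le> 1"
    have "D x = 0"
      by (rule continuous_constant_on_closure[OF continuous]) (use x in \<open>auto simp: D_def interior\<close>)
    then show "component j (axis i x) = Moebius_function 0 (- (\<phi> 0 $ j)) (\<epsilon> * x)"
      by (simp add: D_def)
  qed
qed

lemma component_powers_bounded_on_axis:
  obtains K where "\<And>n. abs_power_series_on (sphere 0 1) (\<lambda>x. component j (axis i x) ^ n) K"
proof -
  obtain K where K: "\<And>n. Aplus_norm (comp_op \<phi> (coord_pow j n)) < K"
    using comp_op_bounded_coord_pow[OF bounded] by metis
  have "abs_power_series_on (sphere 0 1) (\<lambda>x. component j (axis i x) ^ n) K" for n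
  proof -
    have "comp_op \<phi> (coord_pow j n) \<in> Aplus"
      by (rule comp_op_in_Aplus[OF bounded]) simp
    then have "abs_power_series_on (cball 0 1) (\<lambda>x. comp_op \<phi> (coord_pow j n) (axis i x)) K"
      by (rule abs_power_series_on_axis[OF _ K])
    then have "abs_power_series_on (sphere 0 1) (\<lambda>x. comp_op \<phi> (coord_pow j n) (axis i x)) K"
      by (rule abs_power_series_on_subset) auto
    then show ?thesis
      by (rule abs_power_series_on_cong[THEN iffD1, rotated])
         (simp add: component_def Aplus_automorphism_coord_pow[OF automorphism, of _ j n])
  qed
  then show ?thesis by (rule that)
qed

lemma component_rotation: "\<exists>j \<epsilon>. norm \<epsilon> = 1 \<and> (\<forall>z\<in>polydisc. \<phi> z $ j = \<epsilon> * z $ i)"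
proof -
  obtain j \<epsilon> where \<epsilon>: "norm \<epsilon> = 1" and Moebius: "\<And>x. norm x \<le> 1 \<Longrightarrow>
      component j (axis i x) = Moebius_function 0 (- (\<phi> 0 $ j)) (\<epsilon> * x)"
    using component_Moebius_on_axis[of i] by blast
  obtain K where K: "\<And>n. abs_power_series_on (sphere 0 1) (\<lambda>x. component j (axis i x) ^ n) K"
    using component_powers_bounded_on_axis[of j i] by blast
  have "- (\<phi> 0 $ j) = 0"
  proof (rule Moebius_powers_bounded_imp_zero[OF _ \<epsilon>])
    show "norm (- (\<phi> 0 $ j)) < 1"
      using zero_image_in_polydisc by (simp add: polydisc_def)
    show "abs_power_series_on (sphere 0 1)
        (\<lambda>x. Moebius_function 0 (- (\<phi> 0 $ j)) (\<epsilon> * x) ^ n) K" for n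
      using K[of n] by (rule abs_power_series_on_cong[THEN iffD1, rotated]) (simp add: Moebius)
  qed
  then have axis: "component j (axis i x) = \<epsilon> * x" if "norm x = 1" for x
    using that by (simp add: Moebius Moebius_function_simple)
  have "\<phi> z $ j = \<epsilon> * z $ i" if z: "z \<in> polydisc" for z
    using Aplus_eq_rotation_on_axis_imp_eq[OF component_in_Aplus norm_component_le_1 axis \<epsilon>
        polydisc_imp_cpolydisc[OF z]] by (simp add: component_eq z)
  with \<epsilon> show ?thesis by blast
qed

lemma eq_coord_rotation:
  "\<exists>\<sigma> \<epsilon>. \<sigma> permutes UNIV \<and> (\<forall>i. norm (\<epsilon> i) = 1) \<and>
    (\<forall>z\<in>polydisc. \<phi> z = coord_rotation \<sigma> \<epsilon> z)"
proof -
  obtain \<tau> \<epsilon> where \<epsilon>: "\<And>i. norm (\<epsilon> i) = 1"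
    and \<tau>: "\<And>i z. z \<in> polydisc \<Longrightarrow> \<phi> z $ \<tau> i = \<epsilon> i * z $ i"
    using component_rotation by metis
  have "inj \<tau>"
  proof (rule injI, rule ccontr)
    fix i i'
    assume eq: "\<tau> i = \<tau> i'" and "i \<noteq> i'"
    have "axis i (1/2) \<in> polydisc" by simp
    from \<tau>[OF this, of i] \<tau>[OF this, of i'] have "\<epsilon> i * (1/2) = 0"
      using eq \<open>i \<noteq> i'\<close> by (simp add: axis_def)
    then show False using \<epsilon>[of i] by auto
  qed
  then have bij: "bij \<tau>"
    by (simp add: finite_UNIV_inj_surj bij_def)
  show ?thesis
  proof (intro exI[of _ "inv \<tau>"] exI[of _ "\<lambda>j. \<epsilon> (inv \<tau> j)"] conjI allI ballI)
    show "inv \<tau> permutes UNIV"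
      using bij_imp_bij_inv[OF bij] by (intro bij_imp_permutes) auto
    show "norm (\<epsilon> (inv \<tau> j)) = 1" for j
      by (rule \<epsilon>)
    show "\<phi> z = coord_rotation (inv \<tau>) (\<lambda>j. \<epsilon> (inv \<tau> j)) z" if "z \<in> polydisc" for z
      using \<tau>[OF that, of "inv \<tau> _"] bij
      by (simp add: coord_rotation_def vec_eq_iff surj_f_inv_f bij_is_surj)
  qed
qed

end

theorem theorem11:
  fixes \<phi> :: "complex ^ 'n::finite \<Rightarrow> complex ^ 'n"
  assumes maps: "\<forall>z\<in>polydisc. \<phi> z \<in> cpolydisc"
    and holo: "holomorphic_several \<phi> polydisc"
    and bdd: "comp_op_bounded \<phi>"
  shows "Aplus_automorphism (comp_op \<phi>) \<longleftrightarrow>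
    (\<exists>\<sigma> \<epsilon>. \<sigma> permutes (UNIV :: 'n set) \<and> (\<forall>i. norm (\<epsilon> i) = 1) \<and>
       (\<forall>z\<in>polydisc. \<phi> z = (\<chi> i. \<epsilon> i * z $ \<sigma> i)))"
    (is "?automorphism \<longleftrightarrow> ?rotation")
proof
  assume ?automorphism
  then interpret composition_automorphism \<phi>
    using maps bdd by unfold_locales auto
  show ?rotation
    using eq_coord_rotation unfolding coord_rotation_def .
next
  assume ?rotation
  then show ?automorphism
    using coord_rotation_imp_automorphism[of _ _ \<phi>] unfolding coord_rotation_def by blast
qed

end
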